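(* Let $p\in[1,\infty]$, let $k\geq 1$ be an integer, and let $b\in\mathbb{R}$ satisfy $$\frac{k-1}{k}+h(k,p)<b<\frac{k}{k+1},$$ where $$h(k,p):=\begin{cases}\frac{2p-(p-1)k}{k(k+1)(k+2p)}\vee 0 & \text{if } p<\infty,\\[4pt] \frac14 & \text{if } p=\infty \text{ and } k=1,\\[4pt] 0 & \text{if } p=\infty\text{ and } k>1.\end{cases}$$ Then for every $\varepsilon>0$, $$\lim_{N\to\infty}\mathbb{P}^{b,p}_1\left[\left|\frac{\log\mathcal{H}_p(\mathcal{G}_N)}{\log N}-\frac1{k+1}\right|>\varepsilon\right]=0.$$
   Context: For a positive integer $N$, let $V_N=\{0,\ldots,N-1\}$, $E^\circ_N=\{\{x,x+1\}: x,x+1\in V_N\}$, $\mathscr{E}_N=\{\{x,y\}: x\neq y\in V_N\}$, and let $\mathscr{G}_N$ be the set of graphs $g=(V_N,E_N)$ with $E^\circ_N\subseteq E_N\subseteq\mathscr{E}_N$. For $e=\{x,y\}\in\mathscr{E}_N$, write $|e|=|y-x|$. For $g\in\mathscr{G}_N$, $\mathsf{d}_g(x,y)$ is the graph distance in $g$ (least number of edges of a path from $x$ to $y$). For $p\in[1,\infty)$, $$\mathcal{H}_p(g)=\Big(\frac1{N^2}\sum_{x,y\in V_N}\mathsf{d}_g^p(x,y)\Big)^{1/p},$$ and $\mathcal{H}_\infty(g)=\max_{x,y\in V_N}\mathsf{d}_g(x,y)$. $\mathcal{G}_N=(V_N,\mathcal{E}_N)$ denotes the canonical random graph on $\mathscr{G}_N$.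 $\mathbb{P}_1$ is the probability measure on $\mathscr{G}_N$ under which the events $\{e\in\mathcal{E}_N\}$, for $e\in\mathscr{E}_N$ with $|e|>1$, are independent, each with probability $\exp(-|e|)$ (edges in $E^\circ_N$ are always present). $\mathbb{E}_1$ is the associated expectation. For $b\in\mathbb{R}$ and $p\in[1,\infty]$, $\mathbb{P}^{b,p}_1$ is the probability measure on $\mathscr{G}_N$ given, for every $g\in\mathscr{G}_N$, by $$\mathbb{P}^{b,p}_1[\mathcal{G}_N=g]=\frac{1}{Z^{b,p}_{1,N}}\exp\big(-N^b\,\mathcal{H}_p(g)\big)\,\mathbb{P}_1[\mathcal{G}_N=g],\qquad Z^{b,p}_{1,N}=\mathbb{E}_1\big[\exp(-N^b\mathcal{H}_p(\mathcal{G}_N))\big].$$ The dependence of these measures on $N$ is not displayed. $\vee$ denotes maximum. *)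

theory Defs
  imports "HOL-Probability.Probability"
begin

text \<open>
  A graph on the vertex set \<open>{..<N}\<close> is represented by its set of edges, an edge being a
  two-element set of vertices. Since the edge set does not determine the number of vertices, \<open>N\<close> is
  passed explicitly wherever it matters.
\<close>

definition nn_edges :: "nat \<Rightarrow> nat set set" where
  "nn_edges N = {{x, x + 1} | x. x \<in> {..<N} \<and> x + 1 \<in> {..<N}}"

definition all_edges :: "nat \<Rightarrow> nat set set" where
  "all_edges N = {{x, y} | x y. x \<in> {..<N} \<and> y \<in> {..<N} \<and> x \<noteq> y}"

definition graphs :: "nat \<Rightarrow> nat set set set" where
  "graphs N = {E. nn_edges N \<subseteq> E \<and> E \<subseteq> all_edges N}"

definition edge_length :: "nat set \<Rightarrow> nat" where
  "edge_length e = Max e - Min e"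

lemma edge_length_doubleton: "real (edge_length {x, y}) = \<bar>real y - real x\<bar>"
  by (cases "x \<le> y") (auto simp: edge_length_def max_def min_def)

definition path_between :: "nat set set \<Rightarrow> nat \<Rightarrow> nat \<Rightarrow> nat list \<Rightarrow> bool" where
  "path_between E x y xs \<longleftrightarrow>
     xs \<noteq> [] \<and> hd xs = x \<and> last xs = y \<and> distinct xs \<and> successively (\<lambda>u v. {u, v} \<in> E) xs"

text \<open>
  A path with vertex list \<open>xs\<close> has \<open>length xs - 1\<close> edges. Graphs in \<open>graphs N\<close> are connected, so for
  them the minimum is over a nonempty set.
\<close>

definition gdist :: "nat set set \<Rightarrow> nat \<Rightarrow> nat \<Rightarrow> nat" where
  "gdist E x y = (LEAST n. \<exists>xs. path_between E x y xs \<and> n = length xs - 1)"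

definition Hp :: "nat \<Rightarrow> ereal \<Rightarrow> nat set set \<Rightarrow> real" where
  "Hp N p E =
     (if p = \<infinity> then real (Max {gdist E x y | x y. x \<in> {..<N} \<and> y \<in> {..<N}})
      else (1 / real N ^ 2 * (\<Sum>x<N. \<Sum>y<N. real (gdist E x y) powr real_of_ereal p))
             powr (1 / real_of_ereal p))"

definition long_edges :: "nat \<Rightarrow> nat set set" where
  "long_edges N = {e \<in> all_edges N. edge_length e > 1}"

definition P1 :: "nat \<Rightarrow> nat set set pmf" where
  "P1 N = map_pmf (\<lambda>\<omega>. nn_edges N \<union> {e \<in> long_edges N. \<omega> e})
     (Pi_pmf (long_edges N) False (\<lambda>e. bernoulli_pmf (exp (- real (edge_length e)))))"

definition Zbp :: "nat \<Rightarrow> real \<Rightarrow> ereal \<Rightarrow> real" where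
  "Zbp N b p = measure_pmf.expectation (P1 N) (\<lambda>g. exp (- (real N powr b) * Hp N p g))"

definition Pbp :: "nat \<Rightarrow> real \<Rightarrow> ereal \<Rightarrow> nat set set measure" where
  "Pbp N b p = point_measure (graphs N)
     (\<lambda>g. ennreal (1 / Zbp N b p * exp (- (real N powr b) * Hp N p g) * measure_pmf.prob (P1 N) {g}))"

definition hkp :: "nat \<Rightarrow> ereal \<Rightarrow> real" where
  "hkp k p =
     (if p \<noteq> \<infinity> then
        max ((2 * real_of_ereal p - (real_of_ereal p - 1) * real k)
               / (real k * (real k + 1) * (real k + 2 * real_of_ereal p))) 0
      else if k = 1 then 1 / 4 else 0)"

text \<open>
  The following lemmas check that \<open>P1 N\<close> and \<open>Pbp N b p\<close> are the intended probability measures.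
\<close>

lemma finite_all_edges: "finite (all_edges N)"
  by (rule finite_subset[of _ "Pow {..<N}"]) (auto simp: all_edges_def)

lemma finite_graphs: "finite (graphs N)"
  by (rule finite_subset[of _ "Pow (all_edges N)"]) (auto simp: graphs_def finite_all_edges)

lemma finite_long_edges: "finite (long_edges N)"
  by (simp add: long_edges_def finite_all_edges)

lemma nn_edges_subset: "nn_edges N \<subseteq> all_edges N"
  unfolding nn_edges_def all_edges_def
proof safe
  fix x assume "x < N" "x + 1 < N"
  then show "\<exists>x' y'. {x, x + 1} = {x', y'} \<and> x' \<in> {..<N} \<and> y' \<in> {..<N} \<and> x' \<noteq> y'"
    by (intro exI[of _ x] exI[of _ "x + 1"]) auto
qed

lemma edge_length_nn: "e \<in> nn_edges N \<Longrightarrow> edge_length e = 1"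
  by (auto simp: nn_edges_def edge_length_def)

lemma set_P1: "set_pmf (P1 N) \<subseteq> graphs N"
  using nn_edges_subset by (auto simp: P1_def graphs_def long_edges_def)

lemma prob_P1_edge:
  assumes "e \<in> long_edges N"
  shows "measure_pmf.prob (P1 N) {g. e \<in> g} = exp (- real (edge_length e))"
proof -
  let ?q = "\<lambda>e. bernoulli_pmf (exp (- real (edge_length e)))"
  have "e \<notin> nn_edges N"
    using assms edge_length_nn by (auto simp: long_edges_def)
  then have "measure_pmf.prob (P1 N) {g. e \<in> g} =
      measure_pmf.prob (Pi_pmf (long_edges N) False ?q) ((\<lambda>\<omega>. \<omega> e) -` {True})"
    using assms by (simp add: P1_def vimage_def)
  also have "\<dots> = measure_pmf.prob (map_pmf (\<lambda>\<omega>. \<omega> e) (Pi_pmf (long_edges N) False ?q)) {True}"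
    by simp
  also have "map_pmf (\<lambda>\<omega>. \<omega> e) (Pi_pmf (long_edges N) False ?q) = ?q e"
    using assms by (simp add: Pi_pmf_component finite_long_edges)
  finally show ?thesis
    by (simp add: measure_pmf_single)
qed

lemma indep_P1_edges:
  "prob_space.indep_events (measure_pmf (P1 N)) (\<lambda>e. {g. e \<in> g}) (long_edges N)"
  unfolding prob_space.indep_events_def[OF measure_pmf.prob_space_axioms]
proof (intro conjI allI impI)
  fix J assume J: "J \<subseteq> long_edges N" "J \<noteq> {}" "finite J"
  let ?q = "\<lambda>e. bernoulli_pmf (exp (- real (edge_length e)))"
  let ?B = "\<lambda>e. if e \<in> J then {True} else UNIV"
  have disj: "e \<notin> nn_edges N" if "e \<in> J" for e
    using that J edge_length_nn by (fastforce simp: long_edges_def)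
  have "(\<lambda>\<omega>. nn_edges N \<union> {e \<in> long_edges N. \<omega> e}) -` (\<Inter>e\<in>J. {g. e \<in> g}) = Pi (long_edges N) ?B"
    using disj J by (auto simp: Pi_def split: if_splits)
  then have "measure_pmf.prob (P1 N) (\<Inter>e\<in>J. {g. e \<in> g}) =
      measure_pmf.prob (Pi_pmf (long_edges N) False ?q) (Pi (long_edges N) ?B)"
    unfolding P1_def measure_map_pmf by simp
  also have "\<dots> = (\<Prod>e\<in>long_edges N. measure_pmf.prob (?q e) (?B e))"
    by (rule measure_Pi_pmf_Pi) (rule finite_long_edges)
  also have "\<dots> = (\<Prod>e\<in>J. measure_pmf.prob (?q e) (?B e))"
    using J by (intro prod.mono_neutral_right finite_long_edges) auto
  also have "\<dots> = (\<Prod>e\<in>J. measure_pmf.prob (P1 N) {g. e \<in> g})"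
    using J by (intro prod.cong refl) (auto simp: prob_P1_edge measure_pmf_single)
  finally show "measure_pmf.prob (P1 N) (\<Inter>e\<in>J. {g. e \<in> g}) =
      (\<Prod>e\<in>J. measure_pmf.prob (P1 N) {g. e \<in> g})" .
qed auto

lemma Zbp_eq_sum: "Zbp N b p = (\<Sum>g\<in>graphs N. exp (- (real N powr b) * Hp N p g) * pmf (P1 N) g)"
  unfolding Zbp_def using set_P1
  by (subst integral_measure_pmf[OF finite_graphs]) (auto simp: mult.commute)

lemma Zbp_pos: "Zbp N b p > 0"
proof -
  obtain g where g: "g \<in> set_pmf (P1 N)"
    using set_pmf_not_empty by fast
  then show ?thesis
    unfolding Zbp_eq_sum using set_P1
    by (intro sum_pos2[OF finite_graphs, of g]) (auto simp: pmf_positive)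
qed

lemma measure_Pbp_singleton:
  assumes "g \<in> graphs N"
  shows "measure (Pbp N b p) {g} =
    1 / Zbp N b p * exp (- (real N powr b) * Hp N p g) * measure_pmf.prob (P1 N) {g}"
  using assms Zbp_pos[of N b p] unfolding Pbp_def measure_def
  by (subst emeasure_point_measure_finite[OF finite_graphs]) auto

lemma prob_space_Pbp: "prob_space (Pbp N b p)"
proof
  have "emeasure (Pbp N b p) (space (Pbp N b p)) =
     (\<Sum>g\<in>graphs N. ennreal (exp (- (real N powr b) * Hp N p g) * pmf (P1 N) g / Zbp N b p))"
    unfolding Pbp_def
    by (simp add: space_point_measure emeasure_point_measure_finite[OF finite_graphs]
        measure_pmf_single)
  also have "\<dots> = ennreal (Zbp N b p / Zbp N b p)"
    using Zbp_pos[of N b p]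
    by (subst sum_ennreal) (auto simp: Zbp_eq_sum sum_divide_distrib[symmetric] less_imp_le)
  finally show "emeasure (Pbp N b p) (space (Pbp N b p)) = 1"
    using Zbp_pos[of N b p] by simp
qed

end

theory Submission
  imports Defs "HOL-Real_Asymp.Real_Asymp"
begin

text \<open>
  A graph pays its total edge length (through \<open>P1\<close>) and its energy \<open>N powr b * Hp\<close>. The reference is a
  ladder with \<open>k\<close> scales: edges of length \<open>m ^ j\<close> join consecutive multiples of \<open>m ^ j\<close>, for
  \<open>1 \<le> j \<le> k\<close> and \<open>m\<close> of order \<open>N powr (1 / (k + 1))\<close>. It costs at most \<open>k * N\<close> in length and has
  diameter of order \<open>m\<close>, so the partition function is at least
  \<open>exp (- k * N - C * N powr (b + 1 / (k + 1)))\<close> (\<open>Zbp_ge\<close>). Every other value of \<open>Hp\<close> is compared with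
  this, and the question is how much length a graph must spend to have small distances.

  The answer is combinatorial. Suppose every vertex of an interval can leave it by a walk of at most \<open>T\<close>
  edges. Then two such walks cover the interval, and the interior of each of their edges has the same
  property without that edge. Iterating this \<open>k\<close> times yields of the order of \<open>T ^ k\<close> edges that cover
  all but of the order of \<open>T ^ k\<close> gaps between neighbouring vertices at least \<open>k\<close> times
  (\<open>covered_k_times\<close>). Hence a graph in which all but a fraction \<open>1 / t\<close> of the vertices is within
  distance \<open>T\<close> of a root contains a set \<open>F\<close> of long edges with total length at least
  \<open>k * N - O (N / t + T ^ k)\<close> and cardinality \<open>O (T ^ k)\<close>. By Markov's inequality
  \<open>T = Hp * t powr (1 / p)\<close> is admissible (\<open>small_Hp_needs_long_edges\<close>). A union bound over \<open>F\<close>, in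
  which each edge accounts for a factor \<open>N powr 2\<close> of entropy, turns this into an estimate of
  probabilities (\<open>weight_le_of_paying_edges\<close>).

  Upper tail: if \<open>Hp\<close> is at least \<open>N powr (1 / (k + 1) + \<epsilon>)\<close>, the graph can save length compared with
  \<open>k * N\<close>, but for a good choice of \<open>t\<close> the saving is at most half of its energy, by the lower bound on
  \<open>b\<close> (\<open>exponent_gap\<close>, \<open>large_Hp_pays\<close>). The other half of the energy exceeds the energy of the ladder by
  a power of \<open>N\<close>. Lower tail: if \<open>Hp\<close> is at most \<open>N powr (1 / (k + 1) - \<epsilon>)\<close>, the same argument with
  \<open>k + 1\<close> in place of \<open>k\<close> shows that the graph spends almost \<open>(k + 1) * N\<close> on length
  (\<open>tiny_Hp_overpays\<close>), while the ladder gets by with \<open>k * N\<close> and, as \<open>b + 1 / (k + 1) < 1\<close>, an energy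
  of smaller order than \<open>N\<close>.
\<close>

section \<open>Coverage of gaps by edges of walks\<close>

text \<open>
The natural number \<open>x\<close> also stands for the gap between the vertices \<open>x\<close> and \<open>x + 1\<close>. An edge
covers as many gaps as it is long, so edge lengths can be summed gap by gap.
\<close>

definition covers :: "nat set \<Rightarrow> nat \<Rightarrow> bool" where
  "covers e x \<longleftrightarrow> (\<exists>u\<in>e. \<exists>v\<in>e. u \<le> x \<and> x < v)"

fun walk_edges :: "nat list \<Rightarrow> nat set set" where
  "walk_edges (x # y # xs) = insert {x, y} (walk_edges (y # xs))"
| "walk_edges [x] = {}"
| "walk_edges [] = {}"

definition coverage :: "nat set set \<Rightarrow> nat \<Rightarrow> nat" where
  "coverage F x = card {e \<in> F. covers e x}"

definition total_length :: "nat set set \<Rightarrow> nat" where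
  "total_length F = (\<Sum>e\<in>F. edge_length e)"

definition exits_within :: "nat \<Rightarrow> nat set set \<Rightarrow> nat set \<Rightarrow> nat \<Rightarrow> bool" where
  "exits_within T E I x \<longleftrightarrow>
     (\<exists>xs. xs \<noteq> [] \<and> hd xs = x \<and> last xs \<notin> I \<and> walk_edges xs \<subseteq> E \<and> length xs \<le> T + 1)"

lemma walk_edges_subset_iff:
  "walk_edges xs \<subseteq> E \<longleftrightarrow> successively (\<lambda>u v. {u, v} \<in> E) xs"
  by (induction xs rule: walk_edges.induct) auto

lemma finite_walk_edges [simp]: "finite (walk_edges xs)"
  by (induction xs rule: walk_edges.induct) auto

lemma card_walk_edges: "card (walk_edges xs) \<le> length xs - 1"
proof (induction xs rule: walk_edges.induct)
  case (1 x y xs)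
  then show ?case
    using card_insert_le_m1[of "Suc (length xs)" "walk_edges (y # xs)" "{x, y}"] by simp
qed auto

lemma walk_covers:
  assumes "xs \<noteq> []" and "(hd xs \<le> x) \<noteq> (last xs \<le> x)"
  shows "\<exists>e\<in>walk_edges xs. covers e x"
  using assms
proof (induction xs rule: walk_edges.induct)
  case (1 u v xs)
  show ?case
  proof (cases "(u \<le> x) = (v \<le> x)")
    case True
    then show ?thesis using 1 by auto
  next
    case False
    then have "covers {u, v} x" by (auto simp: covers_def)
    then show ?thesis by auto
  qed
qed auto

lemma covers_doubleton: "a < b \<Longrightarrow> covers {a, b} x \<longleftrightarrow> a \<le> x \<and> x < b"
  by (auto simp: covers_def)

lemma edge_length_ordered: "a < b \<Longrightarrow> edge_length {a, b} = b - a"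
  by (simp add: edge_length_def max_def min_def)

text \<open>
The walk is cut off at its first vertex outside \<open>I\<close>. Each of its edges then has an end in \<open>I\<close>, so an
edge \<open>e\<close> that avoids \<open>I\<close> is not among them. This is what allows an edge to be deleted once the
argument restricts to the interior of that edge.
\<close>

lemma exits_within_delete:
  assumes "exits_within T E J x" and "x \<in> I" and "I \<subseteq> J" and "e \<inter> I = {}"
  shows "exits_within T (E - {e}) I x"
proof -
  have "\<exists>ys. ys \<noteq> [] \<and> hd ys = hd xs \<and> last ys \<notin> I \<and> walk_edges ys \<subseteq> E - {e} \<and> length ys \<le> length xs"
    if "xs \<noteq> []" "hd xs \<in> I" "last xs \<notin> I" "walk_edges xs \<subseteq> E" for xs
    using that
  proof (induction xs rule: walk_edges.induct)
    case (1 u v xs)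
    have ne: "{u, v} \<in> E - {e}" using 1 assms(4) by auto
    show ?case
    proof (cases "v \<in> I")
      case True
      with 1 obtain ys where ys: "ys \<noteq> []" "hd ys = v" "last ys \<notin> I"
        "walk_edges ys \<subseteq> E - {e}" "length ys \<le> length (v # xs)" by auto
      then obtain zs where zs: "ys = v # zs" by (cases ys) auto
      show ?thesis using ys ne by (intro exI[of _ "u # ys"]) (auto simp: zs)
    next
      case False
      then show ?thesis using ne by (intro exI[of _ "[u, v]"]) auto
    qed
  qed auto
  moreover obtain xs where "xs \<noteq> []" "hd xs = x" "last xs \<notin> J" "walk_edges xs \<subseteq> E" "length xs \<le> T + 1"
    using assms(1) unfolding exits_within_def by blast
  ultimately obtain ys where "ys \<noteq> []" "hd ys = x" "last ys \<notin> I" "walk_edges ys \<subseteq> E - {e}"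
    "length ys \<le> T + 1"
    using assms(2,3) by (meson le_trans subsetD)
  then show ?thesis unfolding exits_within_def by blast
qed

text \<open>
Two walks suffice: beyond the last vertex with an exit to the left all exits are to the right, and the
walks from the two vertices of \<open>G\<close> on either side of this change sweep over the rest of \<open>G\<close>.
\<close>

lemma few_edges_cover:
  assumes "finite G" and "G \<subseteq> {lo..<hi}"
    and exit: "\<forall>x\<in>G. exits_within T E {lo..<hi} x"
  obtains Q z where "Q \<subseteq> E" "finite Q" "card Q \<le> 2 * T"
    "\<forall>x\<in>G - {z}. \<exists>e\<in>Q. covers e x"
proof -
  obtain w where w: "\<And>x. x \<in> G \<Longrightarrow> w x \<noteq> [] \<and> hd (w x) = x \<and> last (w x) \<notin> {lo..<hi} \<and>
      walk_edges (w x) \<subseteq> E \<and> length (w x) \<le> T + 1"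
    using exit unfolding exits_within_def by metis
  \<comment> \<open>\<open>L\<close> collects the vertices whose chosen walk leaves to the left. The walk of the rightmost
    of them passes over everything in the interval to its left; of the vertices beyond it, which all
    leave to the right, the leftmost has a walk passing over everything to its right. Only the
    vertex \<open>Max L\<close> itself may be missed.\<close>
  define L where "L = {x \<in> G. last (w x) < lo}"
  define R where "R = {x \<in> G. \<forall>y\<in>L. y < x}"
  define QL where "QL = (if L = {} then {} else walk_edges (w (Max L)))"
  define QR where "QR = (if R = {} then {} else walk_edges (w (Min R)))"
  have fin: "finite L" "finite R" using assms(1) by (auto simp: L_def R_def)
  have L: "Max L \<in> G" "last (w (Max L)) < lo" if "L \<noteq> {}"
    using Max_in[OF fin(1) that] by (auto simp: L_def)
  have R: "Min R \<in> G" "last (w (Min R)) \<ge> hi" if "R \<noteq> {}"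
  proof -
    have *: "Min R \<in> R" using Min_in[OF fin(2) that] .
    then show "Min R \<in> G" by (auto simp: R_def)
    have "Min R \<notin> L" using * by (auto simp: R_def)
    then show "last (w (Min R)) \<ge> hi"
      using w[of "Min R"] * by (auto simp: R_def L_def)
  qed
  have card_le: "card (walk_edges (w x)) \<le> T" if "x \<in> G" for x
    using card_walk_edges[of "w x"] w[OF that] by linarith
  have cL: "card QL \<le> T" using card_le[OF L(1)] by (auto simp: QL_def)
  have cR: "card QR \<le> T" using card_le[OF R(1)] by (auto simp: QR_def)
  have cQ: "card (QL \<union> QR) \<le> 2 * T" using card_Un_le[of QL QR] cL cR by linarith
  have sub: "QL \<union> QR \<subseteq> E" using w L R by (auto simp: QL_def QR_def)
  have cov: "\<exists>e\<in>QL \<union> QR. covers e x" if x: "x \<in> G" "x \<noteq> Max L" for x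
  proof (cases "x \<in> R")
    case True
    then have ne: "R \<noteq> {}" and "Min R \<le> x" using fin by auto
    moreover have "x < hi" using x assms(2) by auto
    ultimately have "\<exists>e\<in>walk_edges (w (Min R)). covers e x"
      using walk_covers[of "w (Min R)" x] w[OF R(1)] R(2)[OF ne] by auto
    then show ?thesis using ne by (auto simp: QR_def)
  next
    case False
    then obtain y where y: "y \<in> L" "x \<le> y" using x by (auto simp: R_def)
    then have ne: "L \<noteq> {}" by auto
    have "x < Max L" using Max_ge[OF fin(1) y(1)] y(2) x by linarith
    moreover have "lo \<le> x" using x assms(2) by auto
    ultimately have "\<exists>e\<in>walk_edges (w (Max L)). covers e x"
      using walk_covers[of "w (Max L)" x] w[OF L(1)] L(2) ne by auto
    then show ?thesis using ne by (auto simp: QL_def)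
  qed
  have "finite (QL \<union> QR)" by (auto simp: QL_def QR_def)
  from that[OF sub this cQ, of "Max L"] show thesis using cov by auto
qed

lemma coverage_mono: "finite F' \<Longrightarrow> F \<subseteq> F' \<Longrightarrow> coverage F x \<le> coverage F' x"
  unfolding coverage_def by (rule card_mono) auto

text \<open>
Induction on \<open>k\<close>. At most \<open>2 * T\<close> edges cover all gaps of \<open>G\<close> but one. The interior of each of these
edges \<open>e\<close> again has the exit property in the graph without \<open>e\<close>, since a walk that leaves it cannot
use \<open>e\<close> before it is outside. By induction it is covered \<open>k\<close> times by few edges different from \<open>e\<close>,
and \<open>e\<close> covers it once more. If \<open>c\<^sub>k\<close> bounds both the number of edges and the number of gaps
that are written off, then \<open>c\<^sub>k\<^sub>+\<^sub>1 = 2 * T * (c\<^sub>k + 1) + 1\<close>, whence the bound.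

That \<open>F\<close> itself is small matters as much as that it covers: it is the number of edges in \<open>F\<close> that
determines how many choices of \<open>F\<close> there are.
\<close>

lemma covered_k_times:
  assumes "finite G" and "G \<subseteq> {lo..<hi}"
    and "\<forall>x\<in>G. exits_within T E {lo..<hi} x"
    and "\<forall>e\<in>E. \<exists>a b. a < b \<and> e = {a, b}"
  shows "\<exists>F\<subseteq>{e \<in> E. edge_length e > 1}. finite F \<and> card F < (2 * T + 2) ^ k \<and>
           card {x \<in> G. coverage F x < k} < (2 * T + 2) ^ k"
  using assms
proof (induction k arbitrary: G lo hi E)
  case 0
  show ?case by (intro exI[of _ "{}"]) auto
next
  case (Suc k)
  define X where "X = (2 * T + 2) ^ k"
  have X: "X > 0" by (simp add: X_def)
  obtain Q z where Q: "Q \<subseteq> E" "finite Q" "card Q \<le> 2 * T"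
    "\<forall>x\<in>G - {z}. \<exists>e\<in>Q. covers e x"
    by (rule few_edges_cover[OF Suc.prems(1-3)])
  \<comment> \<open>The gap at \<open>Min e\<close> has its left end on the edge and not strictly inside it, which costs one
    extra gap per edge.\<close>
  define inside where "inside e = {x \<in> G. Min e < x \<and> x < Max e}" for e
  define good where "good e F \<longleftrightarrow> F \<subseteq> {e' \<in> E - {e}. edge_length e' > 1} \<and> finite F \<and>
      card F < X \<and> card {x \<in> inside e. coverage F x < k} < X" for e F
  have "\<exists>F. good e F" if "e \<in> Q" for e
  proof -
    have "e \<in> E" using Q(1) that by (rule subsetD)
    then have "\<exists>a b. a < b \<and> e = {a, b}" using Suc.prems(4) by (rule bspec[rotated])
    then obtain a b where ab: "a < b" "e = {a, b}" by (elim exE conjE)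
    have mm: "Min e = a" "Max e = b" using ab by auto
    show ?thesis unfolding X_def good_def
    proof (rule Suc.IH[where G = "inside e" and lo = "max lo (Suc a)" and hi = "min hi b" and E = "E - {e}"])
      show "finite (inside e)" using Suc.prems(1) by (simp add: inside_def)
      show sub: "inside e \<subseteq> {max lo (Suc a)..<min hi b}"
        using Suc.prems(2) by (auto simp: inside_def mm)
      show "\<forall>x\<in>inside e. exits_within T (E - {e}) {max lo (Suc a)..<min hi b} x"
      proof
        fix x assume x: "x \<in> inside e"
        show "exits_within T (E - {e}) {max lo (Suc a)..<min hi b} x"
        proof (rule exits_within_delete)
          show "exits_within T E {lo..<hi} x" using x Suc.prems(3) by (auto simp: inside_def)
          show "x \<in> {max lo (Suc a)..<min hi b}" using sub x by blast
        qed (auto simp: ab)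
      qed
      show "\<forall>e'\<in>E - {e}. \<exists>a b. a < b \<and> e' = {a, b}" using Suc.prems(4) by blast
    qed
  qed
  then obtain f where "\<forall>e\<in>Q. good e (f e)" using bchoice[of Q good] by blast
  then have f: "f e \<subseteq> {e' \<in> E - {e}. edge_length e' > 1}" "finite (f e)" "card (f e) < X"
    "card {x \<in> inside e. coverage (f e) x < k} < X" if "e \<in> Q" for e
    using that by (auto simp: good_def)
  \<comment> \<open>Edges of length 1 cover a single gap each and are not allowed into \<open>F\<close>, so that gap
    is written off.\<close>
  define Q' where "Q' = {e \<in> Q. edge_length e > 1}"
  define F where "F = (\<Union>e\<in>Q'. insert e (f e))"
  define U where "U e = insert (Min e) {x \<in> inside e. coverage (f e) x < k}" for e
  have finF: "finite F" using Q(2) f by (auto simp: F_def Q'_def)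
  have cQ: "card Q' \<le> 2 * T" using card_mono[OF Q(2), of Q'] Q(3) by (auto simp: Q'_def)
  have "card F \<le> (\<Sum>e\<in>Q'. card (insert e (f e)))"
    unfolding F_def by (rule card_UN_le) (use Q(2) in \<open>auto simp: Q'_def\<close>)
  also have "\<dots> \<le> (\<Sum>e\<in>Q'. X)"
  proof (rule sum_mono)
    fix e assume "e \<in> Q'"
    then have "card (f e) < X" "finite (f e)" using f by (auto simp: Q'_def)
    then show "card (insert e (f e)) \<le> X" by (simp add: card_insert_if)
  qed
  also have "\<dots> \<le> 2 * T * X" using cQ by simp
  finally have cF: "card F \<le> 2 * T * X" .
  have cover: "x \<in> insert z (\<Union>e\<in>Q. U e)" if x: "x \<in> G" "coverage F x < Suc k" for x
  proof (rule ccontr)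
    assume non: "x \<notin> insert z (\<Union>e\<in>Q. U e)"
    then obtain e where e: "e \<in> Q" "covers e x" using Q(4) x by auto
    have "e \<in> E" using Q(1) e(1) by (rule subsetD)
    then have "\<exists>a b. a < b \<and> e = {a, b}" using Suc.prems(4) by (rule bspec[rotated])
    then obtain a b where ab: "a < b" "e = {a, b}" by (elim exE conjE)
    have mm: "Min e = a" "Max e = b" using ab by auto
    have ax: "a < x" "x < b"
      using e(2) non e(1) ab by (auto simp: covers_doubleton U_def mm le_less)
    then have "e \<in> Q'" using e ab by (auto simp: Q'_def edge_length_ordered)
    have "k \<le> coverage (f e) x"
      using non e(1) ax x by (auto simp: U_def inside_def mm not_less)
    moreover have "coverage (insert e (f e)) x = Suc (coverage (f e) x)"
    proof -
      have "{e' \<in> insert e (f e). covers e' x} = insert e {e' \<in> f e. covers e' x}" using e by auto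
      moreover have "e \<notin> f e" using f(1)[OF e(1)] by auto
      ultimately show ?thesis using f(2)[OF e(1)] by (simp add: coverage_def)
    qed
    moreover have "coverage (insert e (f e)) x \<le> coverage F x"
      using \<open>e \<in> Q'\<close> by (intro coverage_mono finF) (auto simp: F_def)
    ultimately show False using x by linarith
  qed
  have finU: "finite (U e)" for e using Suc.prems(1) by (auto simp: U_def inside_def)
  have "card {x \<in> G. coverage F x < Suc k} \<le> card (insert z (\<Union>e\<in>Q. U e))"
    by (rule card_mono) (use cover Q(2) finU in auto)
  also have "\<dots> \<le> Suc (card (\<Union>e\<in>Q. U e))" by (rule card_insert_le_m1) auto
  also have "card (\<Union>e\<in>Q. U e) \<le> (\<Sum>e\<in>Q. card (U e))" by (rule card_UN_le[OF Q(2)])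
  also have "\<dots> \<le> (\<Sum>e\<in>Q. X)"
  proof (rule sum_mono)
    fix e assume "e \<in> Q"
    then have "card {x \<in> inside e. coverage (f e) x < k} < X" using f by auto
    then show "card (U e) \<le> X" unfolding U_def by (intro card_insert_le_m1) auto
  qed
  also have "\<dots> \<le> 2 * T * X" using Q(3) by simp
  finally have "card {x \<in> G. coverage F x < Suc k} \<le> Suc (2 * T * X)" by simp
  moreover have "F \<subseteq> {e \<in> E. edge_length e > 1}"
    using f Q(1) by (fastforce simp: F_def Q'_def)
  moreover have "(2 * T + 2) ^ Suc k = 2 * T * X + 2 * X" by (simp add: X_def algebra_simps)
  ultimately show ?case using finF cF X by (intro exI[of _ F]) auto
qed

section \<open>Graph distance and walks\<close>

lemma all_edges_doubleton:
  assumes "e \<in> all_edges N"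
  shows "\<exists>a b. a < b \<and> e = {a, b} \<and> b < N"
proof -
  obtain x y where "e = {x, y}" "x < N" "y < N" "x \<noteq> y"
    using assms by (auto simp: all_edges_def)
  then have "min x y < max x y \<and> e = {min x y, max x y} \<and> max x y < N"
    by (auto simp: min_def max_def)
  then show ?thesis by (intro exI)
qed

text \<open>
When the next vertex of a walk already lies on the path, the path is cut back to it.
\<close>

lemma relpow_imp_path:
  assumes "(x, y) \<in> {(u, v). {u, v} \<in> E} ^^ n"
  shows "\<exists>xs. path_between E x y xs \<and> length xs \<le> Suc n"
  using assms
proof (induction n arbitrary: y)
  case 0
  then show ?case by (intro exI[of _ "[x]"]) (auto simp: path_between_def)
next
  case (Suc n)
  then obtain z where z: "{z, y} \<in> E" "(x, z) \<in> {(u, v). {u, v} \<in> E} ^^ n" by auto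
  obtain xs where xs: "path_between E x z xs" "length xs \<le> Suc n" using Suc.IH[OF z(2)] by blast
  show ?case
  proof (cases "y \<in> set xs")
    case True
    then obtain as bs where "xs = as @ y # bs" by (auto simp: in_set_conv_decomp)
    then show ?thesis using xs
      by (intro exI[of _ "as @ [y]"])
        (auto simp: path_between_def successively_append_iff hd_append split: if_splits)
  next
    case False
    then show ?thesis using xs z
      by (intro exI[of _ "xs @ [y]"]) (auto simp: path_between_def successively_append_iff)
  qed
qed

lemma gdist_le_relpow:
  assumes "(x, y) \<in> {(u, v). {u, v} \<in> E} ^^ n"
  shows "gdist E x y \<le> n"
proof -
  obtain xs where xs: "path_between E x y xs" "length xs \<le> Suc n"
    using relpow_imp_path[OF assms] by blast
  then have "gdist E x y \<le> length xs - 1" unfolding gdist_def by (intro Least_le) auto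
  then show ?thesis using xs by simp
qed

lemma relpow_progression:
  assumes "\<And>i. c \<le> i \<Longrightarrow> i < a \<Longrightarrow> {i * m, Suc i * m} \<in> E" and "c \<le> a"
  shows "(a * m, c * m) \<in> {(u, v). {u, v :: nat} \<in> E} ^^ (a - c)"
  using assms(2,1)
proof (induction a rule: dec_induct)
  case (step a)
  have "(Suc a * m, a * m) \<in> {(u, v). {u, v} \<in> E}"
    using step.prems[of a] step.hyps by (auto simp: insert_commute)
  moreover have "(a * m, c * m) \<in> {(u, v). {u, v} \<in> E} ^^ (a - c)" using step by auto
  ultimately have "(Suc a * m, c * m) \<in> {(u, v). {u, v} \<in> E} ^^ Suc (a - c)"
    by (rule relpow_Suc_I2)
  then show ?case using step.hyps by (simp add: Suc_diff_le)
qed auto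

lemma relpow_edges_sym:
  "(x, y) \<in> {(u, v). {u, v} \<in> E} ^^ n \<Longrightarrow> (y, x) \<in> {(u, v). {u, v} \<in> E} ^^ n"
proof (induction n arbitrary: y)
  case (Suc n)
  then obtain z where "(x, z) \<in> {(u, v). {u, v} \<in> E} ^^ n" "{z, y} \<in> E" by auto
  then show ?case using Suc.IH by (intro relpow_Suc_I2[of y z]) (auto simp: insert_commute)
qed auto


lemma gdist_path:
  assumes "g \<in> graphs N" and "x < N" and "y < N"
  obtains xs where "path_between g x y xs" and "length xs = Suc (gdist g x y)"
proof -
  let ?R = "{(u, v). {u, v} \<in> g}"
  have down: "(u, 0) \<in> ?R ^^ u" if "u < N" for u
  proof -
    have "{i * 1, Suc i * 1} \<in> g" if "i < u" for i
    proof -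
      have "{i, i + 1} \<in> nn_edges N" using that \<open>u < N\<close> by (force simp: nn_edges_def)
      then show ?thesis using assms(1) by (auto simp: graphs_def)
    qed
    then show ?thesis using relpow_progression[of 0 u 1 g] by auto
  qed
  have "(x, y) \<in> ?R ^^ (x + y)"
    using down[OF assms(2)] relpow_edges_sym[OF down[OF assms(3)]] by (auto simp: relpow_add)
  then obtain xs where "path_between g x y xs" using relpow_imp_path by blast
  then have "\<exists>n. \<exists>xs. path_between g x y xs \<and> n = length xs - 1" by blast
  then have "\<exists>xs. path_between g x y xs \<and> gdist g x y = length xs - 1"
    unfolding gdist_def by (rule LeastI_ex)
  then obtain ys where "path_between g x y ys" "gdist g x y = length ys - 1" by blast
  moreover from this have "length ys > 0" by (simp add: path_between_def)
  ultimately show thesis using that by (metis Suc_pred')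
qed

lemma exits_within_gdist:
  assumes "g \<in> graphs N" and "x < N" and "y < N" and "y \<notin> I" and "gdist g x y \<le> T"
  shows "exits_within T g I x"
proof -
  obtain xs where "path_between g x y xs" "length xs = Suc (gdist g x y)"
    using gdist_path assms(1-3) by blast
  then show ?thesis using assms(4,5)
    unfolding exits_within_def path_between_def walk_edges_subset_iff by auto
qed

section \<open>Short distances require long edges\<close>

lemma total_length_eq_sum_coverage:
  assumes "F \<subseteq> all_edges N"
  shows "total_length F = (\<Sum>x<N. coverage F x)"
proof -
  have fin: "finite F" using assms finite_all_edges finite_subset by blast
  have "edge_length e = card {x \<in> {..<N}. covers e x}" if "e \<in> F" for e
  proof -
    have "e \<in> all_edges N" using that assms by blast
    from all_edges_doubleton[OF this] obtain a b where ab: "a < b" "e = {a, b}" "b < N"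
      by (elim exE conjE)
    then have "{x \<in> {..<N}. covers e x} = {a..<b}" by (auto simp: covers_doubleton)
    then show ?thesis using ab by (simp add: edge_length_ordered)
  qed
  then have "total_length F = (\<Sum>e\<in>F. \<Sum>x<N. if covers e x then 1 else 0)"
    unfolding total_length_def by (simp add: sum.If_cases Int_def)
  also have "\<dots> = (\<Sum>x<N. \<Sum>e\<in>F. if covers e x then 1 else 0)" by (rule sum.swap)
  also have "\<dots> = (\<Sum>x<N. coverage F x)"
    using fin by (simp add: coverage_def sum.If_cases Int_def)
  finally show ?thesis .
qed

text \<open>
A path to the root \<open>r\<close> leaves every interval that does not contain \<open>r\<close>. The covering lemma therefore
applies on either side of \<open>r\<close> to the vertices within distance \<open>T\<close>, and total length is coverage
summed over all gaps. The gaps next to far vertices are written off.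
\<close>

lemma short_distances_need_long_edges:
  assumes g: "g \<in> graphs N" and r: "r < N"
  shows "\<exists>F\<subseteq>long_edges N. F \<subseteq> g \<and> card F \<le> 2 * (2 * T + 2) ^ k \<and>
           k * N \<le> total_length F + k * (card {x \<in> {..<N}. T < gdist g x r} + 2 * (2 * T + 2) ^ k)"
proof -
  define X where "X = (2 * T + 2) ^ k"
  define G where "G = {x \<in> {..<N}. gdist g x r \<le> T}"
  have all: "g \<subseteq> all_edges N" using g by (simp add: graphs_def)
  have dbl: "\<exists>a b. a < b \<and> e = {a, b}" if "e \<in> g" for e
  proof -
    have "e \<in> all_edges N" using that all by blast
    from all_edges_doubleton[OF this] show ?thesis by (elim exE conjE) (intro exI conjI)
  qed
  have long: "{e \<in> g. edge_length e > 1} = g \<inter> long_edges N"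
    using all by (auto simp: long_edges_def)
  have cov_in: "\<exists>F\<subseteq>g \<inter> long_edges N. finite F \<and> card F < X \<and>
           card {x \<in> G \<inter> {lo..<hi}. coverage F x < k} < X" if "r \<notin> {lo..<hi}" for lo hi
  proof -
    have "\<exists>F\<subseteq>{e \<in> g. edge_length e > 1}. finite F \<and> card F < (2 * T + 2) ^ k \<and>
           card {x \<in> G \<inter> {lo..<hi}. coverage F x < k} < (2 * T + 2) ^ k"
    proof (rule covered_k_times)
      show "\<forall>x\<in>G \<inter> {lo..<hi}. exits_within T g {lo..<hi} x"
        using exits_within_gdist[OF g _ r that] by (auto simp: G_def)
      show "\<forall>e\<in>g. \<exists>a b. a < b \<and> e = {a, b}" using dbl by blast
    qed (auto simp: G_def)
    then show ?thesis unfolding long X_def .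
  qed
  obtain F1 where F1: "F1 \<subseteq> g \<inter> long_edges N" "finite F1" "card F1 < X"
      "card {x \<in> G \<inter> {0..<r}. coverage F1 x < k} < X"
    using cov_in[of 0 r] by auto
  obtain F2 where F2: "F2 \<subseteq> g \<inter> long_edges N" "finite F2" "card F2 < X"
      "card {x \<in> G \<inter> {Suc r..<N}. coverage F2 x < k} < X"
    using cov_in[of "Suc r" N] by auto
  \<comment> \<open>The root \<open>r\<close> lies in neither of the two intervals, so every vertex close to it has a short
    walk that leaves its interval.\<close>
  define F where "F = F1 \<union> F2"
  have "card F \<le> 2 * X" using card_Un_le[of F1 F2] F1(3) F2(3) by (simp add: F_def)
  have cov: "coverage F1 x \<le> coverage F x" "coverage F2 x \<le> coverage F x" for x
    using F1(2) F2(2) by (auto simp: F_def intro!: coverage_mono)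
  define U where "U = {x \<in> {..<N}. coverage F x < k}"
  define B where "B = {x \<in> {..<N}. T < gdist g x r}"
  define U1 where "U1 = {x \<in> G \<inter> {0..<r}. coverage F1 x < k}"
  define U2 where "U2 = {x \<in> G \<inter> {Suc r..<N}. coverage F2 x < k}"
  have "x \<in> B \<union> ({r} \<union> (U1 \<union> U2))" if "x \<in> U" for x
    using that cov[of x] by (auto simp: U_def G_def B_def U1_def U2_def)
  then have "card U \<le> card (B \<union> ({r} \<union> (U1 \<union> U2)))"
    by (intro card_mono) (auto simp: B_def U1_def U2_def)
  also have "\<dots> \<le> card B + (1 + (card U1 + card U2))"
    using card_Un_le[of B "{r} \<union> (U1 \<union> U2)"] card_Un_le[of "{r}" "U1 \<union> U2"]
      card_Un_le[of U1 U2] by simp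
  also have "\<dots> \<le> card B + 2 * X" using F1(4) F2(4) by (simp add: U1_def U2_def)
  finally have cU: "card U \<le> card {x \<in> {..<N}. T < gdist g x r} + 2 * X" by (simp add: B_def)
  have "k * N = (\<Sum>x<N. k)" by simp
  also have "\<dots> \<le> (\<Sum>x<N. coverage F x + (if x \<in> U then k else 0))"
    by (intro sum_mono) (auto simp: U_def)
  also have "\<dots> = total_length F + k * card U"
  proof -
    have "F \<subseteq> all_edges N" using F1(1) F2(1) by (auto simp: F_def long_edges_def)
    moreover have "{..<N} \<inter> U = U" by (auto simp: U_def)
    ultimately show ?thesis
      by (simp add: sum.distrib total_length_eq_sum_coverage sum.If_cases)
  qed
  also have "\<dots> \<le> total_length F + k * (card {x \<in> {..<N}. T < gdist g x r} + 2 * X)"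
    using cU by simp
  finally have "k * N \<le> total_length F + k * (card {x \<in> {..<N}. T < gdist g x r} + 2 * X)" .
  moreover have "F \<subseteq> long_edges N" "F \<subseteq> g" using F1(1) F2(1) by (auto simp: F_def)
  ultimately show ?thesis using \<open>card F \<le> 2 * X\<close> unfolding X_def by blast
qed

section \<open>Averaged distances\<close>

text \<open>
The exponent \<open>1 / p\<close>, extended by \<open>1 / \<infinity> = 0\<close>; it allows a uniform treatment of all \<open>p\<close>.
\<close>

definition inv_exponent :: "ereal \<Rightarrow> real" where
  "inv_exponent p = (if p = \<infinity> then 0 else 1 / real_of_ereal p)"

lemma exponent_cases:
  assumes "1 \<le> (p :: ereal)"
  obtains "p = \<infinity>" | r where "p = ereal r" and "r \<ge> 1"
  using assms by (cases p) auto

lemma inv_exponent_bounds: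
  assumes "1 \<le> p"
  shows "0 \<le> inv_exponent p" "inv_exponent p \<le> 1"
  using assms by (auto elim!: exponent_cases simp: inv_exponent_def)

lemma Hp_nonneg: "0 \<le> Hp N p g"
  by (simp add: Hp_def)

lemma finite_distances: "finite {gdist E x y | x y. x \<in> {..<N} \<and> y \<in> {..<N}}"
  by (rule finite_subset[of _ "(\<lambda>(x, y). gdist E x y) ` ({..<N} \<times> {..<N})"]) auto

lemma Hp_le:
  assumes "1 \<le> p" and "N > 0" and "\<And>x y. x < N \<Longrightarrow> y < N \<Longrightarrow> gdist E x y \<le> D"
  shows "Hp N p E \<le> real D"
  using assms(1)
proof (cases rule: exponent_cases)
  case 1
  have "Max {gdist E x y | x y. x \<in> {..<N} \<and> y \<in> {..<N}} \<le> D"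
    using assms(2,3) by (subst Max_le_iff[OF finite_distances]) auto
  with 1 show ?thesis by (simp add: Hp_def)
next
  case (2 r)
  have "(\<Sum>x<N. \<Sum>y<N. real (gdist E x y) powr r) \<le> (\<Sum>x<N. \<Sum>y<N. real D powr r)"
    using assms(3) 2 by (intro sum_mono powr_mono2) auto
  also have "\<dots> = real N ^ 2 * real D powr r" by (simp add: power2_eq_square)
  finally have "1 / real N ^ 2 * (\<Sum>x<N. \<Sum>y<N. real (gdist E x y) powr r) \<le> real D powr r"
    using assms(2) by (simp add: field_simps)
  then have "(1 / real N ^ 2 * (\<Sum>x<N. \<Sum>y<N. real (gdist E x y) powr r)) powr (1 / r) \<le>
      (real D powr r) powr (1 / r)"
    using 2 by (intro powr_mono2) (auto intro!: sum_nonneg divide_nonneg_nonneg)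
  also have "\<dots> = real D" using 2 by (simp add: powr_powr)
  finally show ?thesis using 2 by (simp add: Hp_def)
qed

text \<open>
Markov's inequality for the \<open>p\<close>-th power of the distance to a root \<open>r\<close> whose \<open>p\<close>-th moment of the
distance is at most the average over all roots. For \<open>p = \<infinity>\<close> no vertex is far.
\<close>

lemma few_far_vertices:
  assumes p: "1 \<le> p" and "N > 0" and t: "t > 0" and T: "T \<ge> 1"
    and HT: "Hp N p g * t powr inv_exponent p \<le> T"
  shows "\<exists>r<N. real (card {x \<in> {..<N}. T < real (gdist g x r)}) \<le> real N / t"
  using p
proof (cases rule: exponent_cases)
  case 1
  have "real (gdist g x 0) \<le> T" if "x < N" for x
  proof -
    have "gdist g x 0 \<le> Max {gdist g x y | x y. x \<in> {..<N} \<and> y \<in> {..<N}}"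
      using that \<open>N > 0\<close> by (intro Max_ge[OF finite_distances]) blast
    then show ?thesis using HT t 1 by (simp add: Hp_def inv_exponent_def)
  qed
  then have "{x \<in> {..<N}. T < real (gdist g x 0)} = {}" by force
  then show ?thesis using \<open>N > 0\<close> t by (intro exI[of _ 0]) (simp del: Collect_empty_eq)
next
  case (2 s)
  define H where "H = Hp N p g"
  have H: "H \<ge> 0" by (simp add: H_def Hp_nonneg)
  have Hs: "real N ^ 2 * H powr s = (\<Sum>x<N. \<Sum>y<N. real (gdist g x y) powr s)"
    using 2 \<open>N > 0\<close> by (simp add: H_def Hp_def powr_powr sum_nonneg)
  also have "\<dots> = (\<Sum>y<N. \<Sum>x<N. real (gdist g x y) powr s)" by (rule sum.swap)
  finally have Hs: "(\<Sum>y<N. \<Sum>x<N. real (gdist g x y) powr s) = real N ^ 2 * H powr s" by simp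
  have "\<exists>r<N. (\<Sum>x<N. real (gdist g x r) powr s) \<le> real N * H powr s"
  proof (rule ccontr)
    assume "\<not> ?thesis"
    then have "(\<Sum>y<N. real N * H powr s) < (\<Sum>y<N. \<Sum>x<N. real (gdist g x y) powr s)"
      using \<open>N > 0\<close> by (intro sum_strict_mono) (auto simp: not_le)
    then show False using Hs by (simp add: power2_eq_square)
  qed
  then obtain r where r: "r < N" "(\<Sum>x<N. real (gdist g x r) powr s) \<le> real N * H powr s" by blast
  define B where "B = {x \<in> {..<N}. T < real (gdist g x r)}"
  have "real (card B) * T powr s = (\<Sum>x\<in>B. T powr s)" by simp
  also have "\<dots> \<le> (\<Sum>x\<in>B. real (gdist g x r) powr s)"
    using T 2 by (intro sum_mono powr_mono2) (auto simp: B_def)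
  also have "\<dots> \<le> (\<Sum>x<N. real (gdist g x r) powr s)"
    by (intro sum_mono2) (auto simp: B_def)
  finally have 1: "real (card B) * T powr s \<le> real N * H powr s" using r by linarith
  have "(H * t powr (1 / s)) powr s \<le> T powr s"
    using HT 2 H by (intro powr_mono2) (auto simp: H_def inv_exponent_def)
  then have "H powr s * t \<le> T powr s"
    using 2 H t by (simp add: powr_mult powr_powr)
  then have "real N * H powr s \<le> real N * (T powr s / t)"
    using t by (intro mult_left_mono) (auto simp: field_simps)
  with 1 have "real (card B) * T powr s \<le> real N / t * T powr s" by (simp add: algebra_simps)
  then have "real (card B) \<le> real N / t" using T by (subst (asm) mult_le_cancel_right) auto
  then show ?thesis using r by (auto simp: B_def)
qed

lemma small_Hp_needs_long_edges:
  assumes g: "g \<in> graphs N" and "1 \<le> p" and "N > 0" and "t > 0" and "T \<ge> 1"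
    and "Hp N p g * t powr inv_exponent p \<le> T"
  shows "\<exists>F\<subseteq>long_edges N. F \<subseteq> g \<and> real (card F) \<le> 2 * (4 * T) ^ k \<and>
           real k * real N \<le> real (total_length F) + real k * (real N / t + 2 * (4 * T) ^ k)"
proof -
  obtain r where r: "r < N" "real (card {x \<in> {..<N}. T < real (gdist g x r)}) \<le> real N / t"
    using few_far_vertices[OF assms(2-6)] by blast
  define n where "n = nat \<lfloor>T\<rfloor>"
  have n: "real (2 * n + 2) \<le> 4 * T" using \<open>T \<ge> 1\<close> by (simp add: n_def) linarith
  have far: "(n < d) = (T < real d)" for d using \<open>T \<ge> 1\<close> unfolding n_def by linarith
  obtain F where F: "F \<subseteq> long_edges N" "F \<subseteq> g" "card F \<le> 2 * (2 * n + 2) ^ k"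
    "k * N \<le> total_length F + k * (card {x \<in> {..<N}. n < gdist g x r} + 2 * (2 * n + 2) ^ k)"
    using short_distances_need_long_edges[OF g r(1), of n k] by blast
  have pw: "real ((2 * n + 2) ^ k) \<le> (4 * T) ^ k"
    unfolding of_nat_power by (rule power_mono[OF n]) simp
  have "real (card F) \<le> real (2 * (2 * n + 2) ^ k)" using F(3) of_nat_mono by blast
  also have "\<dots> \<le> 2 * (4 * T) ^ k" using pw by simp
  finally have c: "real (card F) \<le> 2 * (4 * T) ^ k" .
  have "real k * real N \<le> real (total_length F + k * (card {x \<in> {..<N}. n < gdist g x r} + 2 * (2 * n + 2) ^ k))"
    using of_nat_mono[OF F(4), where 'a = real] by simp
  also have "\<dots> = real (total_length F) + real k * (real (card {x \<in> {..<N}. T < real (gdist g x r)})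
      + 2 * real ((2 * n + 2) ^ k))" by (simp add: far)
  also have "\<dots> \<le> real (total_length F) + real k * (real N / t + 2 * (4 * T) ^ k)"
    using r(2) pw by (intro add_mono mult_left_mono) auto
  finally show ?thesis using F c by blast
qed

section \<open>Union bound over edge sets\<close>

lemma prob_P1_superset:
  assumes "F \<subseteq> long_edges N"
  shows "measure_pmf.prob (P1 N) {g. F \<subseteq> g} = exp (- real (total_length F))"
proof (cases "F = {}")
  case False
  have fin: "finite F" using assms finite_long_edges finite_subset by blast
  have "{g. F \<subseteq> g} = (\<Inter>e\<in>F. {g. e \<in> g})" using False by auto
  then have "measure_pmf.prob (P1 N) {g. F \<subseteq> g} = (\<Prod>e\<in>F. measure_pmf.prob (P1 N) {g. e \<in> g})"
    using indep_P1_edges[of N] assms fin False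
    unfolding prob_space.indep_events_def[OF measure_pmf.prob_space_axioms] by metis
  also have "\<dots> = (\<Prod>e\<in>F. exp (- real (edge_length e)))"
    using assms by (intro prod.cong) (auto simp: prob_P1_edge)
  also have "\<dots> = exp (- real (total_length F))"
    using fin by (simp add: total_length_def sum_negf flip: exp_sum)
  finally show ?thesis .
qed (simp add: total_length_def)

lemma sum_pmf_superset:
  assumes "F \<subseteq> long_edges N"
  shows "(\<Sum>g | g \<in> graphs N \<and> F \<subseteq> g. pmf (P1 N) g) = exp (- real (total_length F))"
proof -
  have fin: "finite {g. g \<in> graphs N \<and> F \<subseteq> g}" using finite_graphs[of N] by auto
  have "(\<Sum>g | g \<in> graphs N \<and> F \<subseteq> g. pmf (P1 N) g) =
      measure_pmf.prob (P1 N) {g. g \<in> graphs N \<and> F \<subseteq> g}"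
    by (rule measure_measure_pmf_finite[OF fin, symmetric])
  also have "\<dots> = measure_pmf.prob (P1 N) {g. F \<subseteq> g}"
    using set_P1 by (intro measure_prob_cong_0) (auto simp: pmf_eq_0_set_pmf)
  finally show ?thesis using prob_P1_superset[OF assms] by simp
qed

lemma card_long_edges: "card (long_edges N) \<le> N ^ 2"
proof -
  have "long_edges N \<subseteq> (\<lambda>(x, y). {x, y}) ` ({..<N} \<times> {..<N})"
    by (auto simp: long_edges_def all_edges_def)
  then have "card (long_edges N) \<le> card ({..<N} \<times> {..<N})" by (intro surj_card_le) auto
  then show ?thesis by (simp add: power2_eq_square)
qed

text \<open>
The weight \<open>N powr (- 2 * card F)\<close> makes the sum the product of \<open>1 + 1 / N ^ 2\<close> over at most \<open>N ^ 2\<close>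
edges.
\<close>

lemma sum_edge_sets_le:
  assumes "N > 0"
  shows "(\<Sum>F\<in>Pow (long_edges N). exp (- 2 * ln (real N) * real (card F))) \<le> exp 1"
proof -
  define S where "S = long_edges N"
  have fin: "finite S" by (simp add: S_def finite_long_edges)
  define a where "a = 1 / real N ^ 2"
  have "exp (- 2 * ln (real N) * real n) = a ^ n" for n
  proof -
    have "exp (- 2 * ln (real N) * real n) = exp (- 2 * ln (real N)) ^ n"
      by (metis exp_of_nat2_mult)
    also have "exp (- 2 * ln (real N)) = a"
      using assms by (simp add: a_def exp_minus exp_double field_simps)
    finally show ?thesis .
  qed
  then have "(\<Sum>F\<in>Pow S. exp (- 2 * ln (real N) * real (card F))) = (\<Sum>F\<in>Pow S. (\<Prod>e\<in>F. a) * (\<Prod>e\<in>S - F. 1))"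
    by simp
  also have "\<dots> = (\<Prod>e\<in>S. a + 1)" by (rule prod_add[OF fin, symmetric])
  also have "\<dots> = (1 + a) ^ card S" by (simp add: add.commute)
  also have "\<dots> \<le> exp a ^ card S" by (intro power_mono exp_ge_add_one_self) (simp add: a_def)
  also have "\<dots> = exp (real (card S) * a)" by (simp add: exp_of_nat_mult)
  also have "\<dots> \<le> exp 1"
  proof -
    have "real (card S) \<le> real N ^ 2" using card_long_edges[of N] unfolding S_def
      by (metis of_nat_le_iff of_nat_power)
    then show ?thesis using assms by (simp add: a_def field_simps)
  qed
  finally show ?thesis by (simp add: S_def)
qed

text \<open>
A union bound over all edge sets \<open>F\<close>. Since \<open>F\<close> is present with probability \<open>exp (- total_length F)\<close>,
each term contributes only \<open>N powr (- 2 * card F)\<close>. The set \<open>F\<close> may depend on \<open>g\<close> in an arbitrary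
way, and so graphs with very different distances are treated at once.
\<close>

lemma weight_le_of_paying_edges:
  assumes "N > 0" and A: "A \<subseteq> graphs N" and "C \<ge> 0"
    and pay: "\<And>g. g \<in> A \<Longrightarrow> \<exists>F\<subseteq>long_edges N. F \<subseteq> g \<and>
        w g \<le> C * exp (real (total_length F) - 2 * ln (real N) * real (card F))"
  shows "(\<Sum>g\<in>A. w g * pmf (P1 N) g) \<le> C * exp 1"
proof -
  define v where "v F = C * exp (real (total_length F) - 2 * ln (real N) * real (card F))" for F
  have v: "v F \<ge> 0" for F using \<open>C \<ge> 0\<close> by (simp add: v_def)
  let ?P = "Pow (long_edges N)"
  have finP: "finite ?P" by (simp add: finite_long_edges)
  have "(\<Sum>g\<in>A. w g * pmf (P1 N) g) \<le> (\<Sum>g\<in>A. (\<Sum>F\<in>?P. if F \<subseteq> g then v F else 0) * pmf (P1 N) g)"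
  proof (intro sum_mono mult_right_mono)
    fix g assume "g \<in> A"
    then obtain F where F: "F \<in> ?P" "F \<subseteq> g" "w g \<le> v F" using pay unfolding v_def by blast
    then have "w g \<le> (if F \<subseteq> g then v F else 0)" by simp
    also have "\<dots> \<le> (\<Sum>F\<in>?P. if F \<subseteq> g then v F else 0)"
      using v by (intro member_le_sum F finP) auto
    finally show "w g \<le> (\<Sum>F\<in>?P. if F \<subseteq> g then v F else 0)" .
  qed auto
  also have "\<dots> \<le> (\<Sum>g\<in>graphs N. (\<Sum>F\<in>?P. if F \<subseteq> g then v F else 0) * pmf (P1 N) g)"
    using v by (intro sum_mono2[OF finite_graphs A] mult_nonneg_nonneg sum_nonneg) auto
  also have "\<dots> = (\<Sum>F\<in>?P. \<Sum>g\<in>graphs N. if F \<subseteq> g then v F * pmf (P1 N) g else 0)"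
    unfolding sum_distrib_right by (subst sum.swap) (auto intro!: sum.cong)
  also have "\<dots> = (\<Sum>F\<in>?P. v F * exp (- real (total_length F)))"
  proof (rule sum.cong)
    fix F assume "F \<in> ?P"
    have "(\<Sum>g\<in>graphs N. if F \<subseteq> g then v F * pmf (P1 N) g else 0) =
        v F * (\<Sum>g | g \<in> graphs N \<and> F \<subseteq> g. pmf (P1 N) g)"
      by (simp add: sum_distrib_left sum.inter_filter[OF finite_graphs] if_distrib cong: if_cong)
    then show "(\<Sum>g\<in>graphs N. if F \<subseteq> g then v F * pmf (P1 N) g else 0) =
        v F * exp (- real (total_length F))"
      using \<open>F \<in> ?P\<close> by (simp add: sum_pmf_superset)
  qed simp
  also have "\<dots> = C * (\<Sum>F\<in>?P. exp (- 2 * ln (real N) * real (card F)))"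
    unfolding sum_distrib_left v_def by (intro sum.cong) (simp_all flip: exp_add)
  also have "\<dots> \<le> C * exp 1"
    using sum_edge_sets_le[OF \<open>N > 0\<close>] \<open>C \<ge> 0\<close> by (intro mult_left_mono) auto
  finally show ?thesis .
qed

lemma prob_Pbp:
  "\<P>(g in Pbp N b p. P g) =
     (\<Sum>g | g \<in> graphs N \<and> P g. exp (- (real N powr b) * Hp N p g) * pmf (P1 N) g) / Zbp N b p"
proof -
  interpret prob_space "Pbp N b p" by (rule prob_space_Pbp)
  have sp: "space (Pbp N b p) = graphs N" "sets (Pbp N b p) = Pow (graphs N)"
    by (auto simp: Pbp_def space_point_measure sets_point_measure)
  have "\<P>(g in Pbp N b p. P g) = (\<Sum>g | g \<in> graphs N \<and> P g. measure (Pbp N b p) {g})"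
    unfolding sp by (rule finite_measure_eq_sum_singleton) (auto simp: sp finite_graphs)
  also have "\<dots> = (\<Sum>g | g \<in> graphs N \<and> P g.
      exp (- (real N powr b) * Hp N p g) * pmf (P1 N) g / Zbp N b p)"
    by (intro sum.cong) (auto simp: measure_Pbp_singleton measure_pmf_single)
  finally show ?thesis by (simp add: sum_divide_distrib)
qed

section \<open>Lower bound on the partition function\<close>

text \<open>
The ladder with the \<open>k\<close> scales \<open>m, m ^ 2, \<dots>, m ^ k\<close>, cut off at \<open>N\<close>. Its cost is
at most \<open>N\<close> in length per scale, since the edges of one scale do not overlap.
\<close>

definition ladder_edges :: "nat \<Rightarrow> nat \<Rightarrow> nat \<Rightarrow> nat set set" where
  "ladder_edges N m k = {{i * m ^ j, Suc i * m ^ j} | i j. j \<in> {1..k} \<and> Suc i * m ^ j < N}"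

lemma ladder_edges_long:
  assumes "m \<ge> 2"
  shows "ladder_edges N m k \<subseteq> long_edges N"
proof
  fix e assume "e \<in> ladder_edges N m k"
  then obtain i j where ij: "e = {i * m ^ j, Suc i * m ^ j}" "j \<ge> 1" "Suc i * m ^ j < N"
    by (auto simp: ladder_edges_def)
  have "m ^ j \<ge> m ^ 1" using assms ij(2) by (intro power_increasing) auto
  then have mj: "m ^ j \<ge> 2" using assms by simp
  then have lt: "i * m ^ j < Suc i * m ^ j" using assms by simp
  have "e \<in> all_edges N" using lt ij unfolding all_edges_def
    by (intro CollectI exI[of _ "i * m ^ j"] exI[of _ "Suc i * m ^ j"]) auto
  moreover have "edge_length e > 1" using mj edge_length_ordered[OF lt] ij(1) by simp
  ultimately show "e \<in> long_edges N" by (simp add: long_edges_def)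
qed

lemma total_length_ladder_edges:
  assumes "m \<ge> 2"
  shows "total_length (ladder_edges N m k) \<le> k * N"
proof -
  define I where "I = (SIGMA j:{1..k}. {i. Suc i * m ^ j < N})"
  have pos: "m ^ j > 0" for j using assms by simp
  have sub: "{i. Suc i * m ^ j < N} \<subseteq> {..<N div m ^ j}" for j
  proof
    fix i assume "i \<in> {i. Suc i * m ^ j < N}"
    then have "Suc i \<le> N div m ^ j" using pos[of j] by (simp add: less_eq_div_iff_mult_less_eq)
    then show "i \<in> {..<N div m ^ j}" by simp
  qed
  have fin: "finite {i. Suc i * m ^ j < N}" for j using sub finite_subset by blast
  have level: "card {i. Suc i * m ^ j < N} * m ^ j \<le> N" for j
  proof -
    have "card {i. Suc i * m ^ j < N} \<le> N div m ^ j" using card_mono[OF _ sub[of j]] by simp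
    then have "card {i. Suc i * m ^ j < N} * m ^ j \<le> N div m ^ j * m ^ j" by simp
    then show ?thesis using div_times_less_eq_dividend[of N "m ^ j"] by linarith
  qed
  have "ladder_edges N m k = (\<lambda>(j, i). {i * m ^ j, Suc i * m ^ j}) ` I"
    by (fastforce simp: ladder_edges_def I_def image_iff)
  then have "total_length (ladder_edges N m k) \<le>
      (\<Sum>ji\<in>I. edge_length ((\<lambda>(j, i). {i * m ^ j, Suc i * m ^ j}) ji))"
    unfolding total_length_def using sum_image_le[of I edge_length] fin
    by (simp add: I_def o_def)
  also have "\<dots> = (\<Sum>(j, i)\<in>I. m ^ j)"
    using pos edge_length_ordered by (intro sum.cong) auto
  also have "\<dots> = (\<Sum>j\<in>{1..k}. \<Sum>i | Suc i * m ^ j < N. m ^ j)"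
    unfolding I_def using fin by (subst sum.Sigma) auto
  also have "\<dots> \<le> (\<Sum>j\<in>{1..k}. N)" using level by (intro sum_mono) simp
  finally show ?thesis by simp
qed

text \<open>
Every vertex walks to \<open>0\<close> by clearing its digits in base \<open>m\<close>, the lowest first: fewer than \<open>m\<close> steps of
length \<open>m ^ j\<close> clear digit \<open>j\<close>, and there are at most \<open>k + 1\<close> digits.
\<close>

lemma ladder_edges_distance:
  assumes g: "g \<in> graphs N" and sub: "ladder_edges N m k \<subseteq> g" and "m \<ge> 2" and "N \<le> m ^ (k + 1)"
    and "x < N" and "y < N"
  shows "gdist g x y \<le> 2 * (k + 1) * m"
proof -
  let ?R = "{(u, v). {u, v} \<in> g}"
  have digits: "\<exists>n\<le>j * m. (u, (u div m ^ j) * m ^ j) \<in> ?R ^^ n" if "u < N" "j \<le> k + 1" for u j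
    using that(2)
  proof (induction j)
    case (Suc j)
    then obtain n where n: "n \<le> j * m" "(u, (u div m ^ j) * m ^ j) \<in> ?R ^^ n" by auto
    define a where "a = u div m ^ j"
    define c where "c = (a div m) * m"
    have ca: "c \<le> a" "a - c < m" using \<open>m \<ge> 2\<close>
      by (auto simp: c_def minus_div_mult_eq_mod)
    have "{i * m ^ j, Suc i * m ^ j} \<in> g" if "i < a" for i
    proof -
      have "Suc i * m ^ j \<le> a * m ^ j" using that by (intro mult_right_mono) auto
      also have "\<dots> \<le> u" by (simp add: a_def)
      finally have lt: "Suc i * m ^ j < N" using \<open>u < N\<close> by linarith
      show ?thesis
      proof (cases "j = 0")
        case True
        then have "{i, i + 1} \<in> nn_edges N" using lt by (force simp: nn_edges_def)
        then show ?thesis using g True by (auto simp: graphs_def)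
      next
        case False
        then have "{i * m ^ j, Suc i * m ^ j} \<in> ladder_edges N m k"
          using lt Suc.prems by (force simp: ladder_edges_def)
        then show ?thesis using sub by blast
      qed
    qed
    then have "(a * m ^ j, c * m ^ j) \<in> ?R ^^ (a - c)"
      using relpow_progression[of c a "m ^ j" g] ca by auto
    then have "(u, c * m ^ j) \<in> ?R ^^ (n + (a - c))"
      using n(2) by (auto simp: relpow_add a_def)
    moreover have "c * m ^ j = (u div m ^ Suc j) * m ^ Suc j"
      by (simp add: c_def a_def div_mult2_eq mult.commute[of m])
    moreover have "n + (a - c) \<le> Suc j * m" using n(1) ca by simp
    ultimately show ?case by metis
  qed (auto intro!: exI[of _ 0])
  have down: "\<exists>n\<le>(k + 1) * m. (u, 0) \<in> ?R ^^ n" if "u < N" for u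
  proof -
    have "u div m ^ (k + 1) = 0" using that \<open>N \<le> m ^ (k + 1)\<close> by simp
    with digits[OF that, of "k + 1"] show ?thesis by simp
  qed
  obtain n where n: "n \<le> (k + 1) * m" "(x, 0) \<in> ?R ^^ n" using down \<open>x < N\<close> by blast
  obtain n' where n': "n' \<le> (k + 1) * m" "(y, 0) \<in> ?R ^^ n'" using down \<open>y < N\<close> by blast
  have "(x, y) \<in> ?R ^^ (n + n')"
    using n(2) relpow_edges_sym[OF n'(2)] by (auto simp: relpow_add)
  then have "gdist g x y \<le> n + n'" by (rule gdist_le_relpow)
  then show ?thesis using n n' by simp
qed

text \<open>
The partition function is at least the contribution of the graphs that contain the ladder with \<open>k\<close>
scales and base \<open>m\<close> of order \<open>N powr (1 / (k + 1))\<close>.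
\<close>

lemma Zbp_ge:
  assumes "1 \<le> p" and "N \<ge> 2"
  shows "Zbp N b p \<ge>
    exp (- real k * real N - 4 * (real k + 1) * real N powr (b + 1 / (real k + 1)))"
proof -
  define m where "m = nat \<lceil>real N powr (1 / (real k + 1))\<rceil>"
  have gt1: "real N powr (1 / (real k + 1)) > 1" using \<open>N \<ge> 2\<close> by (intro gr_one_powr) simp_all
  have m: "real N powr (1 / (real k + 1)) \<le> real m" by (simp add: m_def)
  have "m \<ge> 2" using m gt1 by linarith
  have m2: "real m \<le> 2 * real N powr (1 / (real k + 1))" using gt1 unfolding m_def by linarith
  have "real N = (real N powr (1 / (real k + 1))) ^ (k + 1)"
    using \<open>N \<ge> 2\<close> by (subst powr_realpow[symmetric]) (auto simp: powr_powr add.commute)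
  also have "\<dots> \<le> real m ^ (k + 1)" using m by (intro power_mono) auto
  finally have Nm: "N \<le> m ^ (k + 1)" by (metis of_nat_le_iff of_nat_power)
  let ?F = "ladder_edges N m k"
  define c where "c = exp (- (real N powr b) * (4 * (real k + 1) * real N powr (1 / (real k + 1))))"
  have H: "Hp N p g \<le> 4 * (real k + 1) * real N powr (1 / (real k + 1))"
    if "g \<in> graphs N" "?F \<subseteq> g" for g
  proof -
    have "Hp N p g \<le> real (2 * (k + 1) * m)"
      using assms ladder_edges_distance[OF that \<open>m \<ge> 2\<close> Nm] by (intro Hp_le) auto
    also have "\<dots> = 2 * (real k + 1) * real m" by (simp add: algebra_simps)
    also have "\<dots> \<le> 2 * (real k + 1) * (2 * real N powr (1 / (real k + 1)))"
      using m2 by (intro mult_left_mono) auto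
    finally show ?thesis by (simp add: algebra_simps)
  qed
  have "exp (- real k * real N) \<le> exp (- real (total_length ?F))"
    using total_length_ladder_edges[OF \<open>m \<ge> 2\<close>, of N k] by (simp flip: of_nat_mult)
  then have "c * exp (- real k * real N) \<le> c * (\<Sum>g | g \<in> graphs N \<and> ?F \<subseteq> g. pmf (P1 N) g)"
    using ladder_edges_long[OF \<open>m \<ge> 2\<close>, of N k]
    by (intro mult_left_mono) (auto simp: sum_pmf_superset c_def)
  also have "\<dots> = (\<Sum>g | g \<in> graphs N \<and> ?F \<subseteq> g. c * pmf (P1 N) g)"
    by (rule sum_distrib_left)
  also have "\<dots> \<le> (\<Sum>g | g \<in> graphs N \<and> ?F \<subseteq> g. exp (- (real N powr b) * Hp N p g) * pmf (P1 N) g)"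
    unfolding c_def using H
    by (intro sum_mono mult_right_mono) (auto intro!: mult_left_mono)
  also have "\<dots> \<le> Zbp N b p"
    unfolding Zbp_eq_sum by (intro sum_mono2 finite_graphs) auto
  finally show ?thesis by (simp add: c_def algebra_simps powr_add flip: exp_add)
qed

section \<open>The two tails\<close>

text \<open>
The two inequalities are what \<open>large_Hp_pays\<close> needs at the two ends of the critical range
\<open>N powr (1 / (k + 1)) \<le> Hp \<le> 2 * k * N powr (1 - b)\<close>; between the ends the exponent is linear in
\<open>log Hp\<close>. The upper end amounts to \<open>b > (k - 1) / k\<close>. For the lower end and finite \<open>p\<close>, the threshold
\<open>(k - 1) / k + h\<close> is at least \<open>(k^2 + 2 p k - p) / ((k + 1) (k + 2 p))\<close>, whereas
\<open>b > (k^2 + p k - p) / ((k + 1) (k + p))\<close> is wanted. The former fraction arises from the latter by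
adding \<open>p k\<close> to the numerator and \<open>p\<close> to the factor \<open>k + p\<close>, which cannot decrease it because
\<open>k^2 + p k - p \<le> k (k + p)\<close>.
\<close>

lemma exponent_gap:
  assumes p: "1 \<le> p" and "1 \<le> k" and b: "(real k - 1) / real k + hkp k p < b"
  defines "q \<equiv> inv_exponent p"
  shows "real k - 1 - real k * b < 0"
    and "(real k - 1 - q * real k) / (real k + 1) + (1 - b) * (q * real k) - b < 0"
proof -
  have k: "real k \<ge> 1" using \<open>1 \<le> k\<close> by simp
  have "hkp k p \<ge> 0" by (simp add: hkp_def)
  then have "(real k - 1) / real k < b" using b by linarith
  then show kb: "real k - 1 - real k * b < 0" using k by (simp add: field_simps)
  have "real k - 1 + real k ^ 2 * q < b * (real k + 1) * (1 + q * real k)"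
    using p
  proof (cases rule: exponent_cases)
    case 1
    have "b \<ge> 0" using kb k by (smt (verit) mult_nonneg_nonpos)
    then show ?thesis using kb 1 by (simp add: q_def inv_exponent_def algebra_simps)
  next
    case (2 r)
    define D where "D = real k * (real k + 1) * (real k + 2 * r)"
    have D: "D > 0" using k 2 by (simp add: D_def)
    have "(2 * r - (r - 1) * real k) / D \<le> hkp k p" using 2 by (simp add: hkp_def D_def)
    then have "(real k - 1) / real k + (2 * r - (r - 1) * real k) / D < b" using b by linarith
    also have "(real k - 1) / real k + (2 * r - (r - 1) * real k) / D =
        (real k ^ 2 + 2 * r * real k - r) / ((real k + 1) * (real k + 2 * r))"
      using k 2 unfolding D_def by (simp add: divide_simps) (simp add: algebra_simps power2_eq_square)
    finally have "real k ^ 2 + 2 * r * real k - r < b * ((real k + 1) * (real k + 2 * r))"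
      using k 2 by (subst (asm) pos_divide_less_eq) auto
    then have "(real k ^ 2 + 2 * r * real k - r) * (real k + r) <
        b * ((real k + 1) * (real k + 2 * r)) * (real k + r)"
      using k 2 by (intro mult_strict_right_mono) auto
    moreover have "(real k ^ 2 + 2 * r * real k - r) * (real k + r) =
        ((real k - 1) * r + real k ^ 2) * (real k + 2 * r) + r ^ 2"
      by (simp add: algebra_simps power2_eq_square)
    moreover have "r ^ 2 \<ge> 0" by simp
    ultimately have "((real k - 1) * r + real k ^ 2) * (real k + 2 * r) <
        (b * (real k + 1) * (r + real k)) * (real k + 2 * r)"
      by (simp only: mult_ac add_ac)
    then have "(real k - 1) * r + real k ^ 2 < b * (real k + 1) * (r + real k)"
      using k 2 by (subst (asm) mult_less_cancel_right) auto
    then have "((real k - 1) * r + real k ^ 2) / r < b * (real k + 1) * (r + real k) / r"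
      using 2 by (intro divide_strict_right_mono) auto
    then show ?thesis using 2 by (simp add: q_def inv_exponent_def field_simps)
  qed
  then show "(real k - 1 - q * real k) / (real k + 1) + (1 - b) * (q * real k) - b < 0"
    using k by (simp add: field_simps power2_eq_square)
qed

text \<open>
Half of the energy of a graph with large \<open>Hp\<close> pays for its saving in edge length compared to \<open>k * N\<close>
and for the entropy of the choice of \<open>F\<close>. If the energy is at least \<open>2 * k * N\<close> then \<open>F = {}\<close> will do.
Otherwise \<open>T = Hp * t powr (1 / p)\<close> with \<open>t\<close> just large enough for the vertices farther than \<open>T\<close> to be
affordable; then \<open>T ^ k\<close>, times a logarithm, is of smaller order than the energy \<open>N powr b * Hp\<close>.
\<close>

lemma large_Hp_pays:
  fixes N k :: nat and b :: real
  assumes g: "g \<in> graphs N" and p: "1 \<le> p" and "1 \<le> k" and "N \<ge> 2"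
  defines "q \<equiv> inv_exponent p"
  defines "s \<equiv> real k - 1 - q * real k"
  assumes H: "real N powr (1 / (real k + 1)) \<le> Hp N p g"
    and N: "(2 * real k + 4 * ln (real N)) * (4 ^ k * (8 * real k) powr (q * real k)) *
      (real N powr (s / (real k + 1) + (1 - b) * (q * real k) - b) +
        (2 * real k) powr s * real N powr (real k - 1 - real k * b)) \<le> 1 / 4"
  shows "\<exists>F\<subseteq>long_edges N. F \<subseteq> g \<and>
    real k * real N - real (total_length F) + 2 * ln (real N) * real (card F) \<le> real N powr b * Hp N p g / 2"
proof -
  define h where "h = Hp N p g"
  define n where "n = real N"
  have n: "n \<ge> 2" using \<open>N \<ge> 2\<close> by (simp add: n_def)
  have k: "real k \<ge> 1" using \<open>1 \<le> k\<close> by simp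
  have q: "q \<ge> 0" using inv_exponent_bounds[OF p] by (simp add: q_def)
  have h: "n powr (1 / (real k + 1)) \<le> h" using H by (simp add: h_def n_def)
  have "1 \<le> n powr (1 / (real k + 1))" using n by (intro ge_one_powr_ge_zero) auto
  then have h1: "h \<ge> 1" using h by linarith
  have nb: "n = n powr b * n powr (1 - b)" using n by (simp flip: powr_add)
  show ?thesis
  proof (cases "2 * real k * n powr (1 - b) \<le> h")
    case True
    have "real k * n = n powr b * (2 * real k * n powr (1 - b)) / 2" using nb by simp
    also have "\<dots> \<le> n powr b * h / 2" using True by (intro divide_right_mono mult_left_mono) auto
    finally show ?thesis by (intro exI[of _ "{}"]) (simp add: h_def n_def total_length_def)
  next
    case False
  \<comment> \<open>The choice of \<open>t\<close> makes the write-off \<open>k n / t\<close> for far vertices equal to an eighth of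
      the energy.\<close>
    define t where "t = 8 * real k * n powr (1 - b) / h"
    have t: "t \<ge> 1" using False h1 by (simp add: t_def field_simps)
    define T where "T = h * t powr q"
    have "1 * 1 \<le> T" unfolding T_def using h1 t q by (intro mult_mono ge_one_powr_ge_zero) auto
    then have T: "T \<ge> 1" by simp
    obtain F where F: "F \<subseteq> long_edges N" "F \<subseteq> g" "real (card F) \<le> 2 * (4 * T) ^ k"
      "real k * n \<le> real (total_length F) + real k * (n / t + 2 * (4 * T) ^ k)"
      using small_Hp_needs_long_edges[OF g p, of t T k] t T \<open>N \<ge> 2\<close>
      by (auto simp: T_def h_def q_def n_def)
    define K where "K = (2 * real k + 4 * ln n) * (4 ^ k * (8 * real k) powr (q * real k))"
    have K: "K \<ge> 0" using n by (simp add: K_def)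
    have "(4 * T) ^ k = 4 ^ k * (h ^ k * (t powr q) ^ k)" by (simp add: T_def power_mult_distrib)
    also have "h ^ k = h powr real k" using h1 by (simp add: powr_realpow)
    also have "(t powr q) ^ k = t powr (q * real k)"
      using t by (simp add: powr_powr flip: powr_realpow)
    also have "t powr (q * real k) =
        (8 * real k) powr (q * real k) * n powr ((1 - b) * (q * real k)) * h powr (- (q * real k))"
      using n k h1 by (simp add: t_def powr_mult powr_divide powr_powr powr_minus_divide)
    finally have "(2 * real k + 4 * ln n) * (4 * T) ^ k =
        K * (h powr real k * h powr (- (q * real k)) * n powr ((1 - b) * (q * real k)))"
      by (simp add: K_def mult_ac)
    also have "h powr real k * h powr (- (q * real k)) = h * h powr s"
      using h1 by (simp add: s_def powr_mult_base flip: powr_add)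
    also have "K * (h * h powr s * n powr ((1 - b) * (q * real k))) \<le>
        K * (h * (n powr (s / (real k + 1)) + (2 * real k * n powr (1 - b)) powr s) *
          n powr ((1 - b) * (q * real k)))"
    proof (intro mult_left_mono mult_right_mono K)
      show "h powr s \<le> n powr (s / (real k + 1)) + (2 * real k * n powr (1 - b)) powr s"
      proof (cases "s \<ge> 0")
        case True
        have "h powr s \<le> (2 * real k * n powr (1 - b)) powr s"
          using False h1 True by (intro powr_mono2) auto
        then show ?thesis by (simp add: add_increasing)
      next
        case neg: False
        have "h powr s \<le> (n powr (1 / (real k + 1))) powr s"
          using n h neg by (intro powr_mono2') auto
        then show ?thesis by (simp add: powr_powr add_increasing2)
      qed
    qed (use h1 in auto)
    also have "\<dots> = n powr b * h * (K * (n powr (s / (real k + 1) + (1 - b) * (q * real k) - b) +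
        (2 * real k) powr s * n powr (real k - 1 - real k * b)))"
    proof -
      have "n powr (s / (real k + 1)) * n powr ((1 - b) * (q * real k)) =
          n powr b * n powr (s / (real k + 1) + (1 - b) * (q * real k) - b)"
        by (simp flip: powr_add)
      moreover have "(2 * real k * n powr (1 - b)) powr s * n powr ((1 - b) * (q * real k)) =
          n powr b * ((2 * real k) powr s * n powr (real k - 1 - real k * b))"
      proof -
        have "(1 - b) * s + (1 - b) * (q * real k) = b + (real k - 1 - real k * b)"
          by (simp add: s_def algebra_simps)
        then have "n powr ((1 - b) * s) * n powr ((1 - b) * (q * real k)) =
            n powr b * n powr (real k - 1 - real k * b)" by (simp flip: powr_add)
        then show ?thesis using k n by (simp add: powr_mult powr_powr mult_ac)
      qed
      ultimately show ?thesis by (simp only: distrib_left distrib_right mult_ac)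
    qed
    also have "\<dots> \<le> n powr b * h * (1 / 4)"
      using N h1 by (intro mult_left_mono) (auto simp: K_def n_def)
    finally have main: "(2 * real k + 4 * ln n) * (4 * T) ^ k \<le> n powr b * h / 4" by simp
    have "real k * (n / t) = n powr b * h / 8"
      using k n h1 by (subst nb) (simp add: t_def field_simps)
    moreover have "2 * ln n * real (card F) \<le> 2 * ln n * (2 * (4 * T) ^ k)"
      using F(3) n by (intro mult_left_mono) auto
    moreover have "real k * (n / t + 2 * (4 * T) ^ k) + 2 * ln n * (2 * (4 * T) ^ k) =
        real k * (n / t) + (2 * real k + 4 * ln n) * (4 * T) ^ k"
      by (simp add: algebra_simps)
    moreover have "n powr b * h \<ge> 0" using h1 by simp
    ultimately have "real k * n - real (total_length F) + 2 * ln n * real (card F) \<le> n powr b * h / 2"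
      using F(4) main by linarith
    then show ?thesis using F(1,2) unfolding n_def h_def by blast
  qed
qed

text \<open>
Distances below \<open>N powr (1 / (k + 1))\<close> by a power of \<open>N\<close> force \<open>k + 1\<close> layers of long edges instead
of \<open>k\<close>.
\<close>

lemma tiny_Hp_overpays:
  fixes N k :: nat and \<epsilon> :: real
  assumes g: "g \<in> graphs N" and p: "1 \<le> p" and "N \<ge> 2"
    and e: "0 < \<epsilon>" "\<epsilon> \<le> 1 / (real k + 1)"
    and H: "Hp N p g \<le> real N powr (1 / (real k + 1) - \<epsilon>)"
    and N: "(real k + 1) * real N powr (1 - \<epsilon> / 2) +
      (2 * (real k + 1) + 4 * ln (real N)) * (4 ^ (k + 1) * real N powr (1 - \<epsilon> * (real k + 1) / 2))
        \<le> real N / 2"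
  shows "\<exists>F\<subseteq>long_edges N. F \<subseteq> g \<and>
    (real k + 1) * real N - real (total_length F) + 2 * ln (real N) * real (card F) \<le> real N / 2"
proof -
  define n where "n = real N"
  have n: "n \<ge> 2" using \<open>N \<ge> 2\<close> by (simp add: n_def)
  \<comment> \<open>Half of the gap \<open>\<epsilon>\<close> in the exponent is spent on making far vertices rare, the other half on
    keeping \<open>T ^ (k + 1)\<close> of smaller order than \<open>n\<close>.\<close>
  define t where "t = n powr (\<epsilon> / 2)"
  define T where "T = n powr (1 / (real k + 1) - \<epsilon> / 2)"
  have t: "t \<ge> 1" unfolding t_def using n e by (intro ge_one_powr_ge_zero) auto
  have T: "T \<ge> 1" unfolding T_def using n e by (intro ge_one_powr_ge_zero) auto
  have "Hp N p g * t powr inv_exponent p \<le> n powr (1 / (real k + 1) - \<epsilon>) * t powr 1"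
    using H inv_exponent_bounds[OF p] t by (intro mult_mono powr_mono) (auto simp: n_def)
  also have "\<dots> = T" using t by (simp add: t_def T_def flip: powr_add)
  finally have "Hp N p g * t powr inv_exponent p \<le> T" .
  then obtain F where F: "F \<subseteq> long_edges N" "F \<subseteq> g" "real (card F) \<le> 2 * (4 * T) ^ (k + 1)"
    "real (k + 1) * n \<le> real (total_length F) + real (k + 1) * (n / t + 2 * (4 * T) ^ (k + 1))"
    using small_Hp_needs_long_edges[OF g p, of t T "k + 1"] t T \<open>N \<ge> 2\<close> unfolding n_def by auto
  have "(1 / (real k + 1) - \<epsilon> / 2) * real (k + 1) = 1 - \<epsilon> * (real k + 1) / 2"
    by (simp add: field_simps)
  then have "T ^ (k + 1) = n powr (1 - \<epsilon> * (real k + 1) / 2)"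
    using n unfolding T_def by (subst powr_realpow[symmetric]) (simp_all add: powr_powr del: of_nat_add)
  then have T': "(4 * T) ^ (k + 1) = 4 ^ (k + 1) * n powr (1 - \<epsilon> * (real k + 1) / 2)"
    by (simp only: power_mult_distrib)
  have nt: "n / t = n powr (1 - \<epsilon> / 2)" using n by (simp add: t_def powr_diff)
  have "2 * ln n * real (card F) \<le> 2 * ln n * (2 * (4 * T) ^ (k + 1))"
    using F(3) n by (intro mult_left_mono) auto
  moreover have "real (k + 1) * (n / t + 2 * (4 * T) ^ (k + 1)) + 2 * ln n * (2 * (4 * T) ^ (k + 1)) =
      (real k + 1) * (n / t) + (2 * (real k + 1) + 4 * ln n) * (4 * T) ^ (k + 1)"
    by (simp add: distrib_left distrib_right del: power_Suc)
  moreover have "\<dots> \<le> n / 2" using N unfolding T' nt by (simp add: n_def)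
  moreover have "real (k + 1) * n = (real k + 1) * n" by simp
  ultimately have "(real k + 1) * n - real (total_length F) + 2 * ln n * real (card F) \<le> n / 2"
    using F(4) by linarith
  then show ?thesis using F(1,2) unfolding n_def by blast
qed

text \<open>
The comparison of the event with the ladder graph of \<open>Zbp_ge\<close>. Here \<open>c\<close> is the price of the event:
energy and edge length together, net of entropy.
\<close>

lemma prob_le_of_paying_edges:
  assumes p: "1 \<le> p" and "N \<ge> 2"
    and pay: "\<And>g. g \<in> graphs N \<Longrightarrow> P g \<Longrightarrow> \<exists>F\<subseteq>long_edges N. F \<subseteq> g \<and>
      c - real (total_length F) + 2 * ln (real N) * real (card F) \<le> real N powr b * Hp N p g"
  shows "\<P>(g in Pbp N b p. P g) \<le>
    exp (1 - c + real k * real N + 4 * (real k + 1) * real N powr (b + 1 / (real k + 1)))"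
proof -
  define z where "z = exp (- real k * real N - 4 * (real k + 1) * real N powr (b + 1 / (real k + 1)))"
  have "(\<Sum>g | g \<in> graphs N \<and> P g. exp (- (real N powr b) * Hp N p g) * pmf (P1 N) g) \<le> exp (- c) * exp 1"
  proof (rule weight_le_of_paying_edges)
    fix g assume "g \<in> {g. g \<in> graphs N \<and> P g}"
    then obtain F where "F \<subseteq> long_edges N" "F \<subseteq> g"
      "c - real (total_length F) + 2 * ln (real N) * real (card F) \<le> real N powr b * Hp N p g"
      using pay by blast
    then show "\<exists>F\<subseteq>long_edges N. F \<subseteq> g \<and> exp (- (real N powr b) * Hp N p g) \<le>
        exp (- c) * exp (real (total_length F) - 2 * ln (real N) * real (card F))"
      by (intro exI[of _ F]) (simp flip: exp_add)
  qed (use \<open>N \<ge> 2\<close> in auto)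
  then have "\<P>(g in Pbp N b p. P g) \<le> exp (- c) * exp 1 / Zbp N b p"
    unfolding prob_Pbp using Zbp_pos[of N b p] by (intro divide_right_mono) auto
  also have "\<dots> \<le> exp (- c) * exp 1 / z"
    using Zbp_ge[OF p \<open>N \<ge> 2\<close>, of k b] Zbp_pos[of N b p]
    by (intro divide_left_mono mult_pos_pos) (auto simp: z_def)
  also have "\<dots> = exp (1 - c + real k * real N + 4 * (real k + 1) * real N powr (b + 1 / (real k + 1)))"
    by (simp add: z_def algebra_simps flip: exp_add exp_diff)
  finally show ?thesis .
qed

lemma log_times_powr_tendsto_0:
  fixes a c x :: real
  assumes "x < 0"
  shows "(\<lambda>N. (a + c * ln (real N)) * real N powr x) \<longlonglongrightarrow> 0"
proof -
  have "(\<lambda>N. real N powr x) \<longlonglongrightarrow> 0" "(\<lambda>N. ln (real N) * real N powr x) \<longlonglongrightarrow> 0"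
    using assms by real_asymp+
  then have "(\<lambda>N. a * real N powr x + c * (ln (real N) * real N powr x)) \<longlonglongrightarrow> a * 0 + c * 0"
    by (intro tendsto_intros)
  then show ?thesis by (simp add: algebra_simps)
qed

text \<open>
The half of the energy that \<open>large_Hp_pays\<close> leaves over is at least \<open>N powr (b + 1 / (k + 1) + \<epsilon>) / 2\<close>,
which outweighs the energy of the ladder graph.
\<close>

lemma prob_large_Hp_tendsto_0:
  assumes p: "1 \<le> p" and "1 \<le> k" and b: "(real k - 1) / real k + hkp k p < b"
    and e: "0 < \<epsilon>"
  shows "(\<lambda>N. \<P>(g in Pbp N b p. real N powr (1 / (real k + 1) + \<epsilon>) \<le> Hp N p g)) \<longlonglongrightarrow> 0"
proof -
  define q where "q = inv_exponent p"
  define s where "s = real k - 1 - q * real k"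
  define A where "A = 4 ^ k * (8 * real k) powr (q * real k)"
  define B where "B = (2 * real k) powr s"
  define x where "x = s / (real k + 1) + (1 - b) * (q * real k) - b"
  define y where "y = real k - 1 - real k * b"
  have xy: "x < 0" "y < 0"
    using exponent_gap[OF p \<open>1 \<le> k\<close> b] by (simp_all add: x_def y_def s_def q_def)
  have "((\<lambda>N. (2 * real k + 4 * ln (real N)) * A * (real N powr x + B * real N powr y)) \<longlongrightarrow> 0) sequentially"
  proof -
    have "(\<lambda>N. A * ((2 * real k + 4 * ln (real N)) * real N powr x) +
        A * B * ((2 * real k + 4 * ln (real N)) * real N powr y)) \<longlonglongrightarrow> A * 0 + A * B * 0"
      by (intro tendsto_intros log_times_powr_tendsto_0 xy)
    then show ?thesis by (simp add: algebra_simps)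
  qed
  then have ev: "eventually (\<lambda>N. (2 * real k + 4 * ln (real N)) * A *
      (real N powr x + B * real N powr y) < 1 / 4) sequentially"
    by (rule order_tendstoD) simp
  define u where "u N = exp (1 + 4 * (real k + 1) * real N powr (b + 1 / (real k + 1)) -
      real N powr (b + 1 / (real k + 1) + \<epsilon>) / 2)" for N :: nat
  have bound: "eventually (\<lambda>N. \<P>(g in Pbp N b p. real N powr (1 / (real k + 1) + \<epsilon>) \<le> Hp N p g) \<le> u N) sequentially"
    using ev eventually_ge_at_top[of 2]
  proof eventually_elim
    case (elim N)
    define c where "c = real k * real N + real N powr (b + 1 / (real k + 1) + \<epsilon>) / 2"
    have "\<P>(g in Pbp N b p. real N powr (1 / (real k + 1) + \<epsilon>) \<le> Hp N p g) \<le>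
      exp (1 - c + real k * real N + 4 * (real k + 1) * real N powr (b + 1 / (real k + 1)))"
    proof (rule prob_le_of_paying_edges[OF p \<open>N \<ge> 2\<close>])
      fix g assume g: "g \<in> graphs N" and H: "real N powr (1 / (real k + 1) + \<epsilon>) \<le> Hp N p g"
      have "real N powr (1 / (real k + 1)) \<le> real N powr (1 / (real k + 1) + \<epsilon>)"
        using \<open>N \<ge> 2\<close> e by (intro powr_mono) auto
      then have "real N powr (1 / (real k + 1)) \<le> Hp N p g" using H by linarith
      then obtain F where F: "F \<subseteq> long_edges N" "F \<subseteq> g"
        "real k * real N - real (total_length F) + 2 * ln (real N) * real (card F) \<le>
          real N powr b * Hp N p g / 2"
        using large_Hp_pays[OF g p \<open>1 \<le> k\<close> \<open>N \<ge> 2\<close>, of b] elim(1)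
        unfolding A_def B_def x_def y_def s_def q_def by (auto simp: less_imp_le)
      have "real N powr (b + 1 / (real k + 1) + \<epsilon>) = real N powr b * real N powr (1 / (real k + 1) + \<epsilon>)"
        by (simp add: add.assoc flip: powr_add)
      also have "\<dots> \<le> real N powr b * Hp N p g" using H by (intro mult_left_mono) auto
      finally show "\<exists>F\<subseteq>long_edges N. F \<subseteq> g \<and>
          c - real (total_length F) + 2 * ln (real N) * real (card F) \<le> real N powr b * Hp N p g"
        using F by (intro exI[of _ F]) (auto simp: c_def)
    qed
    then show ?case by (simp add: u_def c_def algebra_simps)
  qed
  have "filterlim (\<lambda>N. 1 + 4 * (real k + 1) * real N powr (b + 1 / (real k + 1)) -
      real N powr (b + 1 / (real k + 1) + \<epsilon>) / 2) at_bot sequentially"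
  proof -
    define a where "a = b + 1 / (real k + 1)"
    have "b > 0"
    proof -
      have "(real k - 1) / real k \<ge> 0" using \<open>1 \<le> k\<close> by simp
      moreover have "hkp k p \<ge> 0" by (simp add: hkp_def)
      ultimately show ?thesis using b by linarith
    qed
    then have "a > 0" by (simp add: a_def add_pos_pos)
    then show ?thesis unfolding a_def[symmetric] using e by real_asymp
  qed
  then have "u \<longlonglongrightarrow> 0" unfolding u_def by (rule filterlim_compose[OF exp_at_bot])
  then show ?thesis
    by (rule tendsto_sandwich[OF always_eventually bound tendsto_const, rotated]) simp
qed

text \<open>
The additional layer of edges costs almost \<open>N\<close>, and the energy \<open>N powr (b + 1 / (k + 1))\<close> of the ladder
graph is of smaller order because \<open>b < k / (k + 1)\<close>.
\<close>

lemma prob_small_Hp_tendsto_0: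
  assumes p: "1 \<le> p" and b: "b < real k / (real k + 1)"
    and e: "0 < \<epsilon>" "\<epsilon> \<le> 1 / (real k + 1)"
  shows "(\<lambda>N. \<P>(g in Pbp N b p. Hp N p g \<le> real N powr (1 / (real k + 1) - \<epsilon>))) \<longlonglongrightarrow> 0"
proof -
  define d where "d = \<epsilon> * (real k + 1) / 2"
  define A where "A = (4 :: real) ^ (k + 1)"
  have d: "d > 0" using e by (simp add: d_def)
  have "(\<lambda>N. (real k + 1) * ((1 + 0 * ln (real N)) * real N powr (- \<epsilon> / 2)) +
      A * ((2 * (real k + 1) + 4 * ln (real N)) * real N powr (- d))) \<longlonglongrightarrow> (real k + 1) * 0 + A * 0"
    using d e by (intro tendsto_intros log_times_powr_tendsto_0) auto
  then have ev: "eventually (\<lambda>N. (real k + 1) * ((1 + 0 * ln (real N)) * real N powr (- \<epsilon> / 2)) +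
      A * ((2 * (real k + 1) + 4 * ln (real N)) * real N powr (- d)) < 1 / 2) sequentially"
    by (rule order_tendstoD) simp
  define u where "u N = exp (1 - real N / 2 + 4 * (real k + 1) * real N powr (b + 1 / (real k + 1)))" for N :: nat
  have bound: "eventually (\<lambda>N. \<P>(g in Pbp N b p. Hp N p g \<le> real N powr (1 / (real k + 1) - \<epsilon>)) \<le> u N) sequentially"
    using ev eventually_ge_at_top[of 2]
  proof eventually_elim
    case (elim N)
    define c where "c = (real k + 1) * real N - real N / 2"
    have "\<P>(g in Pbp N b p. Hp N p g \<le> real N powr (1 / (real k + 1) - \<epsilon>)) \<le>
      exp (1 - c + real k * real N + 4 * (real k + 1) * real N powr (b + 1 / (real k + 1)))"
    proof (rule prob_le_of_paying_edges[OF p \<open>N \<ge> 2\<close>])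
      fix g assume g: "g \<in> graphs N" and H: "Hp N p g \<le> real N powr (1 / (real k + 1) - \<epsilon>)"
      have "(real k + 1) * real N powr (1 - \<epsilon> / 2) + (2 * (real k + 1) + 4 * ln (real N)) *
          (A * real N powr (1 - d)) \<le> real N / 2"
      proof -
        have "real N powr (1 - \<epsilon> / 2) = real N * real N powr (- \<epsilon> / 2)"
          "real N powr (1 - d) = real N * real N powr (- d)"
          using \<open>N \<ge> 2\<close> by (simp_all add: powr_mult_base)
        then have "?thesis \<longleftrightarrow> real N * ((real k + 1) * ((1 + 0 * ln (real N)) * real N powr (- \<epsilon> / 2)) +
            A * ((2 * (real k + 1) + 4 * ln (real N)) * real N powr (- d))) \<le> real N * (1 / 2)"
          by (simp add: algebra_simps)
        then show ?thesis using elim(1) by (metis less_imp_le mult_left_mono of_nat_0_le_iff)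
      qed
      then obtain F where F: "F \<subseteq> long_edges N" "F \<subseteq> g"
        "(real k + 1) * real N - real (total_length F) + 2 * ln (real N) * real (card F) \<le> real N / 2"
        using tiny_Hp_overpays[OF g p \<open>N \<ge> 2\<close> e H] unfolding A_def d_def by blast
      moreover have "0 \<le> real N powr b * Hp N p g" by (simp add: Hp_nonneg)
      ultimately show "\<exists>F\<subseteq>long_edges N. F \<subseteq> g \<and>
          c - real (total_length F) + 2 * ln (real N) * real (card F) \<le> real N powr b * Hp N p g"
        by (intro exI[of _ F]) (auto simp: c_def)
    qed
    then show ?case by (simp add: u_def c_def algebra_simps)
  qed
  have "filterlim (\<lambda>N. 1 - real N / 2 + 4 * (real k + 1) * real N powr (b + 1 / (real k + 1))) at_bot sequentially"
  proof -
    define a where "a = b + 1 / (real k + 1)"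
    have "a < real k / (real k + 1) + 1 / (real k + 1)" using b by (simp add: a_def)
    also have "\<dots> = 1" by (simp add: add_divide_distrib[symmetric])
    finally have "a < 1" .
    then show ?thesis unfolding a_def[symmetric] by real_asymp
  qed
  then have "u \<longlonglongrightarrow> 0" unfolding u_def by (rule filterlim_compose[OF exp_at_bot])
  then show ?thesis
    by (rule tendsto_sandwich[OF always_eventually bound tendsto_const, rotated]) simp
qed

theorem theorem1p2:
  fixes p :: ereal and k :: nat and b :: real
  assumes "1 \<le> p"
    and "1 \<le> k"
    and "(real k - 1) / real k + hkp k p < b"
    and "b < real k / (real k + 1)"
  shows "\<forall>\<epsilon>>0. (\<lambda>N. \<P>(g in Pbp N b p.
           \<bar>ln (Hp N p g) / ln (real N) - 1 / (real k + 1)\<bar> > \<epsilon>)) \<longlonglongrightarrow> 0"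
proof (intro allI impI)
  fix \<epsilon> :: real assume "\<epsilon> > 0"
  \<comment> \<open>The estimate of the lower tail uses a power of \<open>N\<close> with nonnegative exponent; shrinking \<open>\<epsilon>\<close> only
    enlarges the event.\<close>
  define \<delta> where "\<delta> = min \<epsilon> (1 / (real k + 1))"
  have \<delta>: "0 < \<delta>" "\<delta> \<le> 1 / (real k + 1)" "\<delta> \<le> \<epsilon>" using \<open>\<epsilon> > 0\<close> by (auto simp: \<delta>_def)
  let ?a = "1 / (real k + 1)"
  let ?L = "\<lambda>N. \<P>(g in Pbp N b p. real N powr (?a + \<delta>) \<le> Hp N p g)"
  let ?S = "\<lambda>N. \<P>(g in Pbp N b p. Hp N p g \<le> real N powr (?a - \<delta>))"
  have "(\<lambda>N. ?L N + ?S N) \<longlonglongrightarrow> 0 + 0"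
    by (intro tendsto_add prob_large_Hp_tendsto_0 prob_small_Hp_tendsto_0 assms \<delta>)
  moreover have bound: "eventually (\<lambda>N. \<P>(g in Pbp N b p.
      \<bar>ln (Hp N p g) / ln (real N) - ?a\<bar> > \<epsilon>) \<le> ?L N + ?S N) sequentially"
    using eventually_ge_at_top[of 2]
  proof eventually_elim
    case (elim N)
    interpret prob_space "Pbp N b p" by (rule prob_space_Pbp)
    have meas: "{g \<in> space (Pbp N b p). P g} \<in> events" for P
      by (auto simp: Pbp_def space_point_measure sets_point_measure)
    have lnN: "ln (real N) > 0" using elim by simp
    have "real N powr (?a + \<delta>) \<le> Hp N p g \<or> Hp N p g \<le> real N powr (?a - \<delta>)"
      if "\<bar>ln (Hp N p g) / ln (real N) - ?a\<bar> > \<epsilon>" for g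
      \<comment> \<open>With \<open>ln 0 = 0\<close> the logarithm says nothing about \<open>Hp = 0\<close>; that value is in the lower tail.\<close>
    proof (cases "Hp N p g = 0")
      case False
      then have H: "Hp N p g > 0" using Hp_nonneg[of N p g] by linarith
      have Heq: "Hp N p g = real N powr (ln (Hp N p g) / ln (real N))"
        using H lnN elim by (simp add: powr_def)
      have "?a + \<delta> \<le> ln (Hp N p g) / ln (real N) \<or> ln (Hp N p g) / ln (real N) \<le> ?a - \<delta>"
        using that \<delta>(3) by linarith
      then show ?thesis using elim by (subst (1 2) Heq) (auto intro: powr_mono)
    qed simp
    then have "prob {g \<in> space (Pbp N b p). \<bar>ln (Hp N p g) / ln (real N) - ?a\<bar> > \<epsilon>} \<le>
      prob ({g \<in> space (Pbp N b p). real N powr (?a + \<delta>) \<le> Hp N p g} \<union>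
        {g \<in> space (Pbp N b p). Hp N p g \<le> real N powr (?a - \<delta>)})"
      by (intro finite_measure_mono sets.Un meas) blast
    also have "\<dots> \<le> ?L N + ?S N" by (intro measure_Un_le meas)
    finally show ?case .
  qed
  ultimately show "(\<lambda>N. \<P>(g in Pbp N b p. \<bar>ln (Hp N p g) / ln (real N) - ?a\<bar> > \<epsilon>)) \<longlonglongrightarrow> 0"
    by (intro tendsto_sandwich[OF always_eventually bound tendsto_const]) auto
qed

end
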